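(* Let $f:\mathbb{R}\to\mathbb{R}$ be a $\mathcal{C}^\infty$ function all of whose derivatives grow at most polynomially at infinity, with $f''>0$ on $\mathbb{R}$, and suppose there are $R>0$, $\beta>0$ and $c>0$ such that $$\forall\,|p|\geqslant R\qquad c\,|p|^{-\beta}\leqslant f''(p).$$ Let $\mu\in(0,1]$, $\alpha>\mu+\beta$ and $0\leqslant r\leqslant R$. Let $u_0$ be a tempered distribution on $\mathbb{R}$ for which there is a bounded differentiable function $\tilde u:\mathbb{R}\to\mathbb{C}$, with $\tilde u(0)\neq0$ if $\mu\neq1$, such that $$\mathcal{F}u_0(p)=|p|^{\mu-1}\,\tilde u(p)\qquad\text{for all }p\in\mathbb{R}\setminus\{0\},$$ such that for some $M\geqslant0$ one has $|\tilde u(p)|\leqslant M(1+p^2)^{-\frac\alpha2}$ for all $p\in\mathbb{R}$, and such that $\tilde u'\in L^1_{loc}(\mathbb{R})$ and for some $M'\geqslant0$ one has $\|\tilde u'\|_{L^1(n,n+1)}\leqslant M'|n|^{-\alpha}$ for all $n\in\mathbb{Z}$ with $|n|\geqslant r$. Let $u$ be the solution of $[i\partial_t-f(D)]u=0$, $u(0,\cdot)=u_0$, given by $$u(t,x)=\frac{1}{2\pi}\int_{\mathbb{R}}\mathcal{F}u_0(p)\,e^{-itf(p)+ixp}\,dp ,\qquad t>0,\ x\in\mathbb{R}.$$ Then $$\forall\,t\geqslant1\qquad\|u(t,\cdot)\|_{L^\infty(\mathbb{R})}\leqslant c^{(1)}(u_0,f)\,t^{-\frac\mu2}+c^{(2)}(u_0,f)\,t^{-\frac12},$$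 where, with $N:=\lceil R\rceil+1$, $c^{(1)}(u_0,f):=c_{-N}(u_0,f)+c_{+N}(u_0,f)$, $$c_{-N}(u_0,f):=\frac{1}{2\pi}\,\frac5\mu\,\|\tilde u\|_{L^\infty(-N,0)}+\frac1{2\pi}\Big(4\|\tilde u\|_{L^\infty(-N,0)}+\|\tilde u'\|_{L^1(-N,0)}\Big)m_{-N},$$ $$c_{+N}(u_0,f):=\frac{1}{2\pi}\,\frac5\mu\,\|\tilde u\|_{L^\infty(0,N)}+\frac1{2\pi}\Big(4\|\tilde u\|_{L^\infty(0,N)}+\|\tilde u'\|_{L^1(0,N)}\Big)m_{+N},$$ $$m_{+N}:=2\Big(\min_{p\in[0,N]}f''(p)\Big)^{-1}+\big(f'(N+1)-f'(N)\big)^{-1}+\big(f'(0)-f'(-1)\big)^{-1},$$ $$m_{-N}:=2\Big(\min_{p\in[-N,0]}f''(p)\Big)^{-1}+\big(f'(-N)-f'(-N-1)\big)^{-1}+\big(f'(1)-f'(0)\big)^{-1},$$ and $$c^{(2)}(u_0,f):=5\,\frac{2^{\alpha-\mu+1}M}{\pi}\,\frac{\alpha+1-\mu}{\alpha-\mu}+3\,\frac{2^{1-\mu+2\beta}\,(5\cdot2^\alpha M+M')}{\pi\,c}\,\frac{\alpha+1-\mu-\beta}{\alpha-\mu-\beta}.$$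
   Context: Fourier transform convention: $\mathcal{F}v(p)=\int_{\mathbb{R}}v(x)e^{-ixp}\,dx$, extended to tempered distributions. $f(D)$ is the Fourier multiplier $f(D)v=\mathcal{F}^{-1}(f\,\mathcal{F}v)$. Under the hypotheses ($\alpha>\mu$) one has $\mathcal{F}u_0\in L^1(\mathbb{R})$, so the formula for $u$ is well defined for all $t>0$, $x\in\mathbb{R}$. $\lceil\cdot\rceil$ is the ceiling function. *)

theory Defs
  imports
    "HOL-Analysis.Analysis"
    "HOL-Library.Landau_Symbols"
    "HOL-Probability.Essential_Supremum"
begin

section \<open>Smooth functions of a real variable\<close>

definition nth_deriv :: "nat \<Rightarrow> (real \<Rightarrow> 'a::real_normed_vector) \<Rightarrow> real \<Rightarrow> 'a" where
  "nth_deriv k g = ((\<lambda>h x. vector_derivative h (at x)) ^^ k) g"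

definition smooth :: "(real \<Rightarrow> 'a::real_normed_vector) \<Rightarrow> bool" where
  "smooth g \<longleftrightarrow> (\<forall>k x. nth_deriv k g differentiable (at x))"

lemma nth_deriv_real: "nth_deriv k (g :: real \<Rightarrow> real) = (deriv ^^ k) g"
proof -
  have "(\<lambda>h x. vector_derivative h (at x)) = (deriv :: (real \<Rightarrow> real) \<Rightarrow> real \<Rightarrow> real)"
    by (simp add: fun_eq_iff field_derivative_eq_vector_derivative)
  then show ?thesis
    by (simp add: nth_deriv_def)
qed

definition polynomial_growth :: "(real \<Rightarrow> 'a::real_normed_vector) \<Rightarrow> bool" where
  "polynomial_growth g \<longleftrightarrow> (\<exists>m::nat. (\<lambda>p. norm (g p)) \<in> O[at_infinity](\<lambda>p. \<bar>p\<bar> ^ m))"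


section \<open>Tempered distributions and the Fourier transform\<close>

definition schwartz :: "(real \<Rightarrow> complex) \<Rightarrow> bool" where
  "schwartz \<phi> \<longleftrightarrow>
     smooth \<phi> \<and> (\<forall>j k. bounded (range (\<lambda>x. x ^ j *\<^sub>R nth_deriv k \<phi> x)))"

definition schwartz_seminorm :: "nat \<Rightarrow> nat \<Rightarrow> (real \<Rightarrow> complex) \<Rightarrow> real" where
  "schwartz_seminorm j k \<phi> = (SUP x. norm (x ^ j *\<^sub>R nth_deriv k \<phi> x))"

text \<open>A tempered distribution is a functional on all functions of which only the values at
  Schwartz functions matter. Continuity is expressed by domination by finitely many of the
  seminorms that generate the topology of the Schwartz space.\<close>

definition tempered_distribution :: "((real \<Rightarrow> complex) \<Rightarrow> complex) \<Rightarrow> bool" where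
  "tempered_distribution T \<longleftrightarrow>
     (\<forall>\<phi> \<psi>. schwartz \<phi> \<longrightarrow> schwartz \<psi> \<longrightarrow> T (\<lambda>x. \<phi> x + \<psi> x) = T \<phi> + T \<psi>) \<and>
     (\<forall>a \<phi>. schwartz \<phi> \<longrightarrow> T (\<lambda>x. a * \<phi> x) = a * T \<phi>) \<and>
     (\<exists>C m. \<forall>\<phi>. schwartz \<phi> \<longrightarrow>
        norm (T \<phi>) \<le> C * (\<Sum>j\<le>m. \<Sum>k\<le>m. schwartz_seminorm j k \<phi>))"

definition fourier :: "(real \<Rightarrow> complex) \<Rightarrow> real \<Rightarrow> complex" where
  "fourier v p = (LINT x|lebesgue. v x * exp (- \<i> * of_real x * of_real p))"

definition fourier_distr :: "((real \<Rightarrow> complex) \<Rightarrow> complex) \<Rightarrow> (real \<Rightarrow> complex) \<Rightarrow> complex" where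
  "fourier_distr T \<phi> = T (fourier \<phi>)"

text \<open>The tempered distribution \<open>T\<close> is the function \<open>g\<close>.\<close>

definition distr_is_function :: "((real \<Rightarrow> complex) \<Rightarrow> complex) \<Rightarrow> (real \<Rightarrow> complex) \<Rightarrow> bool" where
  "distr_is_function T g \<longleftrightarrow>
     (\<forall>\<phi>. schwartz \<phi> \<longrightarrow>
        integrable lebesgue (\<lambda>p. g p * \<phi> p) \<and> T \<phi> = (LINT p|lebesgue. g p * \<phi> p))"


section \<open>Norms\<close>

definition Linf_norm :: "real set \<Rightarrow> (real \<Rightarrow> complex) \<Rightarrow> ereal" where
  "Linf_norm S g = esssup (lebesgue_on S) (\<lambda>x. ereal (norm (g x)))"

text \<open>Meaningful only if \<open>g\<close> is integrable on \<open>S\<close>; the Bochner integral is \<open>0\<close> otherwise.\<close>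

definition L1_norm :: "real set \<Rightarrow> (real \<Rightarrow> complex) \<Rightarrow> real" where
  "L1_norm S g = (LINT x:S|lebesgue. norm (g x))"

definition locally_L1 :: "(real \<Rightarrow> complex) \<Rightarrow> bool" where
  "locally_L1 g \<longleftrightarrow> (\<forall>a b. g absolutely_integrable_on {a..b})"


section \<open>The constants of the estimate\<close>

text \<open>The minima over an interval are written with \<open>LEAST\<close>, since \<open>Min\<close> is for finite sets.
  They exist whenever \<open>f''\<close> is continuous.\<close>

definition m_plus :: "(real \<Rightarrow> real) \<Rightarrow> int \<Rightarrow> real" where
  "m_plus f N =
     2 * inverse (LEAST y. y \<in> deriv (deriv f) ` {0..of_int N})
     + inverse (deriv f (of_int N + 1) - deriv f (of_int N))
     + inverse (deriv f 0 - deriv f (- 1))"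

definition m_minus :: "(real \<Rightarrow> real) \<Rightarrow> int \<Rightarrow> real" where
  "m_minus f N =
     2 * inverse (LEAST y. y \<in> deriv (deriv f) ` {- of_int N..0})
     + inverse (deriv f (- of_int N) - deriv f (- of_int N - 1))
     + inverse (deriv f 1 - deriv f 0)"

text \<open>In the next two definitions \<open>w\<close> is bounded, so that the essential suprema are finite and
  \<open>real_of_ereal\<close> loses nothing.\<close>

definition c_plus :: "(real \<Rightarrow> real) \<Rightarrow> (real \<Rightarrow> complex) \<Rightarrow> real \<Rightarrow> int \<Rightarrow> real" where
  "c_plus f w \<mu> N =
     (let A = real_of_ereal (Linf_norm {0<..<of_int N} w);
          V = L1_norm {0<..<of_int N} (\<lambda>p. vector_derivative w (at p))
      in 1 / (2 * pi) * (5 / \<mu>) * A + 1 / (2 * pi) * (4 * A + V) * m_plus f N)"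

definition c_minus :: "(real \<Rightarrow> real) \<Rightarrow> (real \<Rightarrow> complex) \<Rightarrow> real \<Rightarrow> int \<Rightarrow> real" where
  "c_minus f w \<mu> N =
     (let A = real_of_ereal (Linf_norm {- of_int N<..<0} w);
          V = L1_norm {- of_int N<..<0} (\<lambda>p. vector_derivative w (at p))
      in 1 / (2 * pi) * (5 / \<mu>) * A + 1 / (2 * pi) * (4 * A + V) * m_minus f N)"

definition const1 :: "(real \<Rightarrow> real) \<Rightarrow> (real \<Rightarrow> complex) \<Rightarrow> real \<Rightarrow> real \<Rightarrow> real" where
  "const1 f w \<mu> R = (let N = \<lceil>R\<rceil> + 1 in c_minus f w \<mu> N + c_plus f w \<mu> N)"

definition const2 :: "real \<Rightarrow> real \<Rightarrow> real \<Rightarrow> real \<Rightarrow> real \<Rightarrow> real \<Rightarrow> real" where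
  "const2 \<alpha> \<mu> \<beta> c M M' =
     5 * (2 powr (\<alpha> - \<mu> + 1) * M / pi) * ((\<alpha> + 1 - \<mu>) / (\<alpha> - \<mu>))
     + 3 * (2 powr (1 - \<mu> + 2 * \<beta>) * (5 * 2 powr \<alpha> * M + M') / (pi * c))
         * ((\<alpha> + 1 - \<mu> - \<beta>) / (\<alpha> - \<mu> - \<beta>))"

end

theory Submission
  imports Defs
begin

text \<open>
  For \<open>t > 0\<close> the phase \<open>\<theta>(p) = t f(p) - x p\<close> is convex, and van der Corput's argument applies
  uniformly in \<open>x\<close>: on an interval where \<open>\<theta>'' \<ge> L\<close> there is a point \<open>q\<close> with
  \<open>\<bar>\<theta>'(p)\<bar> \<ge> L \<bar>p - q\<bar>\<close> (the stationary point, or the endpoint nearest to it), the window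
  \<open>\<bar>p - q\<bar> < \<delta>\<close> is estimated trivially, and outside it one integrates by parts once. With
  \<open>\<delta> = t powr (- 1 / 2)\<close> the singularity at \<open>0\<close> is cut off at \<open>p = \<delta>\<close>, where \<open>p powr (\<mu> - 1)\<close> is
  at most \<open>\<delta> powr (\<mu> - 1)\<close>; this yields the rate \<open>t powr (- \<mu> / 2)\<close> from \<open>[0, N]\<close>. Each unit
  interval \<open>[n, n + 1]\<close> with \<open>n \<ge> N\<close> contributes \<open>t powr (- 1 / 2)\<close> times a summable power of \<open>n\<close>.
  The negative half-line reduces to the positive one by reflection.
\<close>

section \<open>Oscillatory integrals with a convex phase\<close>

lemma absolutely_integrable_continuous_mult:
  fixes h g :: "real \<Rightarrow> complex"
  assumes "continuous_on {a..b} h" "g absolutely_integrable_on {a..b}"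
  shows "(\<lambda>x. h x * g x) absolutely_integrable_on {a..b}"
proof (rule absolutely_integrable_bounded_measurable_product[OF bilinear_times])
  show "h \<in> borel_measurable (lebesgue_on {a..b})"
    using assms(1) by (intro continuous_imp_measurable_on_sets_lebesgue) auto
  show "bounded (h ` {a..b})"
    using assms(1) by (intro compact_imp_bounded compact_continuous_image) auto
qed (use assms in auto)

text \<open>Integration by parts: \<open>cis (- \<theta> p)\<close> is its own derivative divided by
  \<open>- \<i> * \<theta>1 p\<close>, and each division by \<open>\<theta>1\<close> costs at most
  \<open>1 / L\<close>. This leaves boundary values of \<open>g / \<theta>1\<close>, the variation
  of \<open>g\<close>, which gives \<open>T / L\<close>, and the variation of
  \<open>1 / \<theta>1\<close>, which is controlled because \<open>\<theta>1\<close> is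
  monotone.\<close>

lemma oscillatory_integral_monotone_phase:
  fixes g g' :: "real \<Rightarrow> complex" and \<theta> \<theta>1 \<theta>2 :: "real \<Rightarrow> real"
  assumes ab: "a \<le> b"
    and \<theta>: "\<And>p. p \<in> {a..b} \<Longrightarrow> (\<theta> has_real_derivative \<theta>1 p) (at p)"
    and \<theta>1: "\<And>p. p \<in> {a..b} \<Longrightarrow> (\<theta>1 has_real_derivative \<theta>2 p) (at p)"
    and \<theta>2: "continuous_on {a..b} \<theta>2" "\<And>p. p \<in> {a..b} \<Longrightarrow> 0 \<le> \<theta>2 p"
    and L: "L > 0" "(\<forall>p\<in>{a..b}. L \<le> \<theta>1 p) \<or> (\<forall>p\<in>{a..b}. \<theta>1 p \<le> - L)"
    and g: "\<And>p. p \<in> {a..b} \<Longrightarrow> (g has_vector_derivative g' p) (at p)"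
    and g': "g' absolutely_integrable_on {a..b}"
    and S: "\<And>p. p \<in> {a..b} \<Longrightarrow> norm (g p) \<le> S"
    and T: "integral {a..b} (\<lambda>p. norm (g' p)) \<le> T"
  shows "norm (integral {a..b} (\<lambda>p. g p * cis (- \<theta> p))) \<le> (2 * S + T) / L"
proof -
  define h where "h p = inverse (\<theta>1 p)" for p
  define h' where "h' p = - \<theta>2 p * (h p)\<^sup>2" for p
  define e where "e p = cis (- \<theta> p)" for p
  have nz: "\<theta>1 p \<noteq> 0" if "p \<in> {a..b}" for p
    using L that by force
  have h_le: "\<bar>h p\<bar> \<le> 1 / L" if "p \<in> {a..b}" for p
  proof -
    have "L \<le> \<bar>\<theta>1 p\<bar>" using L that by force
    then show ?thesis using L(1) nz[OF that]
      by (simp add: h_def divide_simps)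
  qed
  have S0: "0 \<le> S" using order_trans[OF norm_ge_zero S[of a]] ab by simp
  have h_der: "(h has_real_derivative h' p) (at p)" if "p \<in> {a..b}" for p
    unfolding h_def h'_def using nz[OF that] \<theta>1[OF that]
    by (auto intro!: derivative_eq_intros simp: power2_eq_square)
  have e_der: "(e has_vector_derivative (- \<i> * of_real (\<theta>1 p) * e p)) (at p)" if "p \<in> {a..b}" for p
    unfolding e_def has_vector_derivative_def
    using \<theta>[OF that] unfolding has_field_derivative_def
    by (auto intro!: derivative_eq_intros simp: scaleR_conv_of_real)
  have cont_\<theta>: "continuous_on {a..b} \<theta>" "continuous_on {a..b} \<theta>1" "continuous_on {a..b} g" "continuous_on {a..b} h"
    by (blast intro: continuous_at_imp_continuous_on DERIV_isCont has_vector_derivative_continuous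
        \<theta> \<theta>1 g h_der)+
  have cont_e: "continuous_on {a..b} e"
    unfolding e_def by (intro continuous_intros cont_\<theta>)
  have cont_h': "continuous_on {a..b} h'"
    unfolding h'_def by (intro continuous_intros cont_\<theta> \<theta>2)
  \<comment> \<open>In the derivative of \<open>F\<close>, differentiating \<open>e\<close> restores
    \<open>- \<i> * (g p * e p)\<close> because \<open>h\<close> inverts \<open>\<theta>1\<close>;
    \<open>F1\<close> and \<open>F2\<close> are the terms where the derivative falls on
    \<open>g\<close> and on \<open>h\<close>.\<close>
  define F where "F p = g p * of_real (h p) * e p" for p
  define F1 where "F1 p = (of_real (h p) * e p) * g' p" for p
  define F2 where "F2 p = g p * of_real (h' p) * e p" for p
  have F_int: "((\<lambda>p. F1 p + F2 p - \<i> * (g p * e p)) has_integral (F b - F a)) {a..b}"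
  proof (rule fundamental_theorem_of_calculus[OF ab])
    fix p assume p: "p \<in> {a..b}"
    have hv: "((\<lambda>p. of_real (h p) :: complex) has_vector_derivative of_real (h' p)) (at p)"
      using h_der[OF p] by (simp add: has_vector_derivative_of_real has_real_derivative_iff_has_vector_derivative)
    have "(F has_vector_derivative (g p * of_real (h p)) * (- \<i> * of_real (\<theta>1 p) * e p) + (g p * of_real (h' p) + g' p * of_real (h p)) * e p) (at p)"
      unfolding F_def
      by (intro has_vector_derivative_mult g[OF p] hv e_der[OF p])
    moreover have hh: "of_real (h p) * of_real (\<theta>1 p) = (1::complex)"
      using nz[OF p] by (simp add: h_def)
    have "(g p * of_real (h p)) * (- \<i> * of_real (\<theta>1 p) * e p) + (g p * of_real (h' p) + g' p * of_real (h p)) * e p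
        = F1 p + F2 p - \<i> * (g p * e p)"
      unfolding F1_def F2_def using hh by algebra
    ultimately have "(F has_vector_derivative F1 p + F2 p - \<i> * (g p * e p)) (at p)"
      by simp
    then show "(F has_vector_derivative F1 p + F2 p - \<i> * (g p * e p)) (at p within {a..b})"
      by (rule has_vector_derivative_at_within)
  qed
  have F1_int: "F1 integrable_on {a..b}"
    unfolding F1_def
    by (intro set_lebesgue_integral_eq_integral(1) absolutely_integrable_continuous_mult
        continuous_intros cont_\<theta> cont_e g')
  have F2_int: "F2 integrable_on {a..b}"
    unfolding F2_def by (intro integrable_continuous_interval continuous_intros cont_\<theta> cont_e cont_h')
  have ge_int: "(\<lambda>p. \<i> * (g p * e p)) integrable_on {a..b}"
    by (intro integrable_continuous_interval continuous_intros cont_\<theta> cont_e)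
  have "F b - F a = integral {a..b} F1 + integral {a..b} F2 - \<i> * integral {a..b} (\<lambda>p. g p * e p)"
    using integral_unique[OF F_int] F1_int F2_int ge_int
    by (simp add: Henstock_Kurzweil_Integration.integral_diff Henstock_Kurzweil_Integration.integral_add integrable_add)
  then have "\<i> * integral {a..b} (\<lambda>p. g p * e p) = integral {a..b} F1 + integral {a..b} F2 - F b + F a"
    by (simp add: algebra_simps)
  then have "norm (integral {a..b} (\<lambda>p. g p * e p)) = norm (integral {a..b} F1 + integral {a..b} F2 - F b + F a)"
    by (metis norm_ii norm_mult mult_1)
  also have "\<dots> \<le> norm (integral {a..b} F1) + norm (integral {a..b} F2) + norm (F b) + norm (F a)"
    using norm_triangle_ineq[of "integral {a..b} F1 + integral {a..b} F2 - F b" "F a"]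
      norm_triangle_ineq4[of "integral {a..b} F1 + integral {a..b} F2" "F b"]
      norm_triangle_ineq[of "integral {a..b} F1" "integral {a..b} F2"] by linarith
  also have "norm (F b) \<le> S * \<bar>h b\<bar>"
    using S[of b] ab by (simp add: F_def e_def norm_mult mult_right_mono)
  also have "norm (F a) \<le> S * \<bar>h a\<bar>"
    using S[of a] ab by (simp add: F_def e_def norm_mult mult_right_mono)
  also have "norm (integral {a..b} F1) \<le> integral {a..b} (\<lambda>p. 1 / L * norm (g' p))"
  proof (rule Henstock_Kurzweil_Integration.integral_norm_bound_integral[OF F1_int])
    show "(\<lambda>p. 1 / L * norm (g' p)) integrable_on {a..b}"
      using g' by (intro integrable_on_mult_right) (auto simp: absolutely_integrable_on_def)
    show "norm (F1 p) \<le> 1 / L * norm (g' p)" if "p \<in> {a..b}" for p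
      using mult_right_mono[OF h_le[OF that], of "norm (g' p)"] by (simp add: F1_def e_def norm_mult)
  qed
  also have "\<dots> = 1 / L * integral {a..b} (\<lambda>p. norm (g' p))" by (rule integral_mult_right)
  also have "\<dots> \<le> 1 / L * T" using T L by (intro mult_left_mono) auto
  \<comment> \<open>Since \<open>\<theta>2\<close> is nonnegative, \<open>h\<close> decreases, so
    the absolute value of \<open>h'\<close> integrates exactly to \<open>h a - h b\<close>.\<close>
  also have "norm (integral {a..b} F2) \<le> integral {a..b} (\<lambda>p. S * - h' p)"
  proof (rule Henstock_Kurzweil_Integration.integral_norm_bound_integral[OF F2_int])
    show "(\<lambda>p. S * - h' p) integrable_on {a..b}"
      by (intro integrable_continuous_interval continuous_intros cont_h')
    show "norm (F2 p) \<le> S * - h' p" if "p \<in> {a..b}" for p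
    proof -
      have "\<bar>h' p\<bar> = - h' p" using \<theta>2(2)[OF that] by (simp add: h'_def abs_mult)
      then show ?thesis
        using mult_right_mono[OF S[OF that], of "\<bar>h' p\<bar>"] by (simp add: F2_def e_def norm_mult)
    qed
  qed
  also have "\<dots> = S * (h a - h b)"
  proof -
    have "(h' has_integral (h b - h a)) {a..b}"
      using h_der by (intro fundamental_theorem_of_calculus ab)
        (auto simp: has_real_derivative_iff_has_vector_derivative intro: has_vector_derivative_at_within)
    then show ?thesis by (simp add: integral_unique algebra_simps)
  qed
  finally have *: "norm (integral {a..b} (\<lambda>p. g p * e p)) \<le> 1 / L * T + S * (h a - h b + \<bar>h b\<bar> + \<bar>h a\<bar>)"
    by (simp add: algebra_simps)
  \<comment> \<open>\<open>h\<close> decreases and has constant sign, so its variation is absorbed by the larger boundary term.\<close>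
  have "h a - h b + \<bar>h b\<bar> + \<bar>h a\<bar> \<le> 2 / L"
  proof -
    have "(0 \<le> h a \<and> 0 \<le> h b) \<or> (h a \<le> 0 \<and> h b \<le> 0)"
      using L(2)
    proof
      assume "\<forall>p\<in>{a..b}. L \<le> \<theta>1 p"
      then have "L \<le> \<theta>1 a" "L \<le> \<theta>1 b" using ab by auto
      then show ?thesis using L(1) by (simp add: h_def)
    next
      assume "\<forall>p\<in>{a..b}. \<theta>1 p \<le> - L"
      then have "\<theta>1 a \<le> - L" "\<theta>1 b \<le> - L" using ab by auto
      then show ?thesis using L(1) by (simp add: h_def)
    qed
    then show ?thesis using h_le[of a] h_le[of b] ab by auto
  qed
  from mult_left_mono[OF this S0] * show ?thesis
    by (simp add: e_def add_divide_distrib mult_ac)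
qed

text \<open>A positive lower bound on \<open>\<theta>2\<close> keeps \<open>\<theta>1\<close> away
  from zero except near one point \<open>q\<close>. The window of radius \<open>\<delta>\<close>
  around \<open>q\<close> costs \<open>2 * \<delta> * S\<close>; on each of the two outer pieces
  \<open>\<theta>1\<close> has modulus at least \<open>L * \<delta>\<close>, and the monotone-phase
  bound applies. The radius stays free so that it can later be adapted to \<open>t\<close>.\<close>

lemma van_der_corput:
  fixes g g' :: "real \<Rightarrow> complex" and \<theta> \<theta>1 \<theta>2 :: "real \<Rightarrow> real"
  assumes ab: "a \<le> b"
    and \<theta>: "\<And>p. p \<in> {a..b} \<Longrightarrow> (\<theta> has_real_derivative \<theta>1 p) (at p)"
    and \<theta>1: "\<And>p. p \<in> {a..b} \<Longrightarrow> (\<theta>1 has_real_derivative \<theta>2 p) (at p)"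
    and \<theta>2: "continuous_on {a..b} \<theta>2" "\<And>p. p \<in> {a..b} \<Longrightarrow> L \<le> \<theta>2 p"
    and L: "L > 0" and \<delta>: "\<delta> > 0"
    and g: "\<And>p. p \<in> {a..b} \<Longrightarrow> (g has_vector_derivative g' p) (at p)"
    and g': "g' absolutely_integrable_on {a..b}"
    and S: "\<And>p. p \<in> {a..b} \<Longrightarrow> norm (g p) \<le> S"
    and T: "integral {a..b} (\<lambda>p. norm (g' p)) \<le> T"
  shows "norm (integral {a..b} (\<lambda>p. g p * cis (- \<theta> p))) \<le> 2 * \<delta> * S + 2 * (2 * S + T) / (L * \<delta>)"
proof -
  define G where "G p = g p * cis (- \<theta> p)" for p
  have S0: "0 \<le> S" using order_trans[OF norm_ge_zero S[of a]] ab by simp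
  have g'n: "(\<lambda>p. norm (g' p)) integrable_on {a..b}"
    using g' by (simp add: absolutely_integrable_on_def)
  have T0: "0 \<le> T"
    using Henstock_Kurzweil_Integration.integral_nonneg[OF g'n] T by simp
  have contG: "continuous_on {a..b} G"
    unfolding G_def using \<theta> g
    by (intro continuous_intros continuous_at_imp_continuous_on ballI)
      (auto intro: DERIV_isCont has_vector_derivative_continuous)
  have \<theta>1_increase: "L * (y - x) \<le> \<theta>1 y - \<theta>1 x" if "a \<le> x" "x \<le> y" "y \<le> b" for x y
  proof (cases "x = y")
    case False
    then have "\<exists>z>x. z < y \<and> \<theta>1 y - \<theta>1 x = (y - x) * \<theta>2 z"
      using that \<theta>1 by (intro MVT2) auto
    then obtain z where "x < z" "z < y" "\<theta>1 y - \<theta>1 x = (y - x) * \<theta>2 z" by blast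
    moreover have "(y - x) * L \<le> (y - x) * \<theta>2 z"
      using that \<theta>2(2)[of z] \<open>x < z\<close> \<open>z < y\<close> by (intro mult_left_mono) auto
    ultimately show ?thesis by (simp add: mult.commute)
  qed simp
  \<comment> \<open>\<open>\<theta>1\<close> is strictly increasing. If it changes sign,
    \<open>q\<close> is its zero; otherwise \<open>q\<close> is the endpoint where its modulus is
    least, and one of the two claims is vacuous.\<close>
  obtain q where q: "a \<le> q" "q \<le> b"
    and right: "\<And>p. q < p \<Longrightarrow> p \<le> b \<Longrightarrow> L * (p - q) \<le> \<theta>1 p"
    and left: "\<And>p. p < q \<Longrightarrow> a \<le> p \<Longrightarrow> \<theta>1 p \<le> - (L * (q - p))"
  proof -
    consider "0 \<le> \<theta>1 a" | "\<theta>1 b \<le> 0" | "\<theta>1 a \<le> 0" "0 \<le> \<theta>1 b" by linarith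
    then show thesis
    proof cases
      case 1
      show thesis
      proof (rule that[of a])
        show "L * (p - a) \<le> \<theta>1 p" if "a < p" "p \<le> b" for p
          using that 1 \<theta>1_increase[of a p] by simp
      qed (use ab in auto)
    next
      case 2
      show thesis
      proof (rule that[of b])
        show "\<theta>1 p \<le> - (L * (b - p))" if "p < b" "a \<le> p" for p
          using that 2 \<theta>1_increase[of p b] by simp
      qed (use ab in auto)
    next
      case 3
      have "\<forall>p. a \<le> p \<and> p \<le> b \<longrightarrow> isCont \<theta>1 p"
        using \<theta>1 by (auto intro: DERIV_isCont)
      then obtain q where q: "a \<le> q" "q \<le> b" "\<theta>1 q = 0"
        using IVT[of \<theta>1 a 0 b] 3 ab by blast
      show thesis
      proof (rule that[of q])
        show "L * (p - q) \<le> \<theta>1 p" if "q < p" "p \<le> b" for p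
          using that q \<theta>1_increase[of q p] by simp
        show "\<theta>1 p \<le> - (L * (q - p))" if "p < q" "a \<le> p" for p
          using that q \<theta>1_increase[of p q] by simp
      qed (use q in auto)
    qed
  qed
  \<comment> \<open>The window is clipped to \<open>{a..b}\<close>. Where it sticks out, the outer
    piece on that side shrinks to a point and its integral is 0.\<close>
  define l where "l = max a (q - \<delta>)"
  define r where "r = min b (q + \<delta>)"
  have lr: "a \<le> l" "l \<le> r" "r \<le> b" "r - l \<le> 2 * \<delta>"
    using q \<delta> by (auto simp: l_def r_def)
  \<comment> \<open>The variation over all of \<open>{a..b}\<close> bounds the one over either
    piece, so \<open>T\<close> is charged twice.\<close>
  have piece: "norm (integral {u..v} G) \<le> (2 * S + T) / (L * \<delta>)"
    if uv: "a \<le> u" "u \<le> v" "v \<le> b"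
      "(\<forall>p\<in>{u..v}. L * \<delta> \<le> \<theta>1 p) \<or> (\<forall>p\<in>{u..v}. \<theta>1 p \<le> - (L * \<delta>))" for u v
  proof -
    have sub: "{u..v} \<subseteq> {a..b}" using uv by auto
    have "g' absolutely_integrable_on {u..v}"
      using g' sub by (rule absolutely_integrable_on_subinterval)
    moreover have "integral {u..v} (\<lambda>p. norm (g' p)) \<le> integral {a..b} (\<lambda>p. norm (g' p))"
      by (intro integral_subset_le sub g'n integrable_on_subinterval[OF g'n sub]) auto
    moreover have "0 \<le> \<theta>2 p" if "p \<in> {u..v}" for p
      using \<theta>2(2)[of p] L that sub by auto
    ultimately show ?thesis
      unfolding G_def
      using uv L \<delta> \<theta>2 sub S T \<theta> \<theta>1 g
      by (intro oscillatory_integral_monotone_phase[of u v \<theta> \<theta>1 \<theta>2 "L * \<delta>" g g'])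
        (auto intro: continuous_on_subset)
  qed
  have nn: "0 \<le> (2 * S + T) / (L * \<delta>)" using S0 T0 L \<delta> by simp
  have "norm (integral {a..l} G) \<le> (2 * S + T) / (L * \<delta>)"
  proof (cases "a < q - \<delta>")
    case True
    have "\<theta>1 p \<le> - (L * \<delta>)" if "p \<in> {a..l}" for p
    proof -
      have p: "p < q" "a \<le> p" "\<delta> \<le> q - p" using that True \<delta> by (auto simp: l_def)
      show ?thesis using left[OF p(1,2)] mult_left_mono[OF p(3), of L] L by linarith
    qed
    then show ?thesis using lr by (intro piece) auto
  next
    case False
    then show ?thesis using nn by (simp add: l_def max_def)
  qed
  moreover have "norm (integral {r..b} G) \<le> (2 * S + T) / (L * \<delta>)"
  proof (cases "q + \<delta> < b")
    case True
    have "L * \<delta> \<le> \<theta>1 p" if "p \<in> {r..b}" for p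
    proof -
      have p: "q < p" "p \<le> b" "\<delta> \<le> p - q" using that True \<delta> by (auto simp: r_def)
      show ?thesis using right[OF p(1,2)] mult_left_mono[OF p(3), of L] L by linarith
    qed
    then show ?thesis using lr by (intro piece) auto
  next
    case False
    then show ?thesis using nn by (simp add: r_def min_def)
  qed
  moreover have "norm (integral {l..r} G) \<le> 2 * \<delta> * S"
  proof -
    have "norm (integral {l..r} G) \<le> S * (r - l)"
      using lr S by (intro integral_bound continuous_on_subset[OF contG]) (auto simp: G_def norm_mult)
    also have "\<dots> \<le> S * (2 * \<delta>)" using lr S0 by (intro mult_left_mono)
    finally show ?thesis by (simp add: mult_ac)
  qed
  moreover have split: "integral {a..b} G = integral {a..l} G + integral {l..r} G + integral {r..b} G"
  proof -
    have "G integrable_on {a..b}" "G integrable_on {a..r}"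
      using lr by (auto intro!: integrable_continuous_interval continuous_on_subset[OF contG])
    then show ?thesis
      using Henstock_Kurzweil_Integration.integral_combine[of a r b G]
        Henstock_Kurzweil_Integration.integral_combine[of a l r G] lr by simp
  qed
  ultimately have "norm (integral {a..b} G) \<le> 2 * \<delta> * S + ((2 * S + T) / (L * \<delta>) + (2 * S + T) / (L * \<delta>))"
    unfolding split
    using norm_triangle_ineq[of "integral {a..l} G + integral {l..r} G" "integral {r..b} G"]
      norm_triangle_ineq[of "integral {a..l} G" "integral {l..r} G"] by linarith
  also have "\<dots> = 2 * \<delta> * S + 2 * (2 * S + T) / (L * \<delta>)" by (simp add: add_divide_distrib)
  finally show ?thesis by (simp add: G_def[abs_def])
qed

text \<open>As \<open>\<mu> \<le> 1\<close>, the weight \<open>p powr (\<mu> - 1)\<close> is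
  positive and nonincreasing, so its size and its variation on \<open>{a..b}\<close> are both at
  most \<open>a powr (\<mu> - 1)\<close>. Up to this factor the amplitude is bounded by
  \<open>S\<close> and its variation by \<open>S + V\<close>, which is how \<open>2 * S + T\<close>
  becomes \<open>3 * S + V\<close>.\<close>

lemma van_der_corput_powr:
  fixes w w' :: "real \<Rightarrow> complex" and \<theta> \<theta>1 \<theta>2 :: "real \<Rightarrow> real"
  assumes ab: "0 < a" "a \<le> b" and \<mu>: "\<mu> \<le> 1"
    and \<theta>: "\<And>p. p \<in> {a..b} \<Longrightarrow> (\<theta> has_real_derivative \<theta>1 p) (at p)"
    and \<theta>1: "\<And>p. p \<in> {a..b} \<Longrightarrow> (\<theta>1 has_real_derivative \<theta>2 p) (at p)"
    and \<theta>2: "continuous_on {a..b} \<theta>2" "\<And>p. p \<in> {a..b} \<Longrightarrow> L \<le> \<theta>2 p"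
    and L: "L > 0" and \<delta>: "\<delta> > 0"
    and w: "\<And>p. p \<in> {a..b} \<Longrightarrow> (w has_vector_derivative w' p) (at p)"
    and w': "w' absolutely_integrable_on {a..b}"
    and S: "\<And>p. p \<in> {a..b} \<Longrightarrow> norm (w p) \<le> S"
    and V: "integral {a..b} (\<lambda>p. norm (w' p)) \<le> V"
  shows "norm (integral {a..b} (\<lambda>p. of_real (p powr (\<mu> - 1)) * w p * cis (- \<theta> p)))
     \<le> a powr (\<mu> - 1) * (2 * \<delta> * S + 2 * (3 * S + V) / (L * \<delta>))"
proof -
  define g where "g p = of_real (p powr (\<mu> - 1)) * w p" for p
  define g' where "g' p = of_real (p powr (\<mu> - 1)) * w' p + of_real ((\<mu> - 1) * p powr (\<mu> - 2)) * w p" for p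
  have S0: "0 \<le> S" using order_trans[OF norm_ge_zero S[of a]] ab by simp
  have powr_der: "((\<lambda>p. p powr (\<mu> - 1)) has_real_derivative (\<mu> - 1) * p powr (\<mu> - 2)) (at p)"
    if "p \<in> {a..b}" for p
    using that ab by (auto intro!: derivative_eq_intros simp: algebra_simps)
  have powr_le: "p powr (\<mu> - 1) \<le> a powr (\<mu> - 1)" if "p \<in> {a..b}" for p
    using that ab \<mu> by (intro powr_mono2') auto
  have cw: "continuous_on {a..b} w"
    using w by (intro continuous_at_imp_continuous_on ballI) (auto intro: has_vector_derivative_continuous)
  have g_der: "(g has_vector_derivative g' p) (at p)" if p: "p \<in> {a..b}" for p
  proof -
    have "((\<lambda>p. of_real (p powr (\<mu> - 1)) :: complex) has_vector_derivative of_real ((\<mu> - 1) * p powr (\<mu> - 2))) (at p)"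
      using powr_der[OF p] by (intro has_vector_derivative_of_real)
        (simp add: has_real_derivative_iff_has_vector_derivative)
    from has_vector_derivative_mult[OF this w[OF p]] show ?thesis
      by (simp add: g_def[abs_def] g'_def)
  qed
  have cont_powr: "continuous_on {a..b} (\<lambda>p. p powr e)" for e
    using ab by (intro continuous_intros) auto
  have g'_abs: "g' absolutely_integrable_on {a..b}"
    unfolding g'_def[abs_def]
    by (intro set_integral_add absolutely_integrable_continuous_mult w'
        absolutely_integrable_continuous_real continuous_intros cw cont_powr)
  have w'n: "(\<lambda>p. norm (w' p)) integrable_on {a..b}"
    using w' by (simp add: absolutely_integrable_on_def)
  have powr_int: "((\<lambda>p. S * - ((\<mu> - 1) * p powr (\<mu> - 2))) has_integral S * - (b powr (\<mu> - 1) - a powr (\<mu> - 1))) {a..b}"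
    using powr_der ab
    by (intro has_integral_mult_right has_integral_neg fundamental_theorem_of_calculus)
      (auto simp: has_real_derivative_iff_has_vector_derivative intro: has_vector_derivative_at_within)
  have "integral {a..b} (\<lambda>p. norm (g' p))
      \<le> integral {a..b} (\<lambda>p. a powr (\<mu> - 1) * norm (w' p) + S * - ((\<mu> - 1) * p powr (\<mu> - 2)))"
  proof (rule integral_le)
    show "(\<lambda>p. norm (g' p)) integrable_on {a..b}"
      using g'_abs by (simp add: absolutely_integrable_on_def)
    show "(\<lambda>p. a powr (\<mu> - 1) * norm (w' p) + S * - ((\<mu> - 1) * p powr (\<mu> - 2))) integrable_on {a..b}"
      by (intro integrable_add integrable_on_mult_right w'n has_integral_integrable[OF powr_int])
    fix p assume p: "p \<in> {a..b}"
    have "norm (g' p) \<le> p powr (\<mu> - 1) * norm (w' p) + norm (w p) * ((1 - \<mu>) * p powr (\<mu> - 2))"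
      unfolding g'_def using \<mu>
      by (intro norm_triangle_le) (simp add: norm_mult abs_mult mult_ac del: of_real_diff of_real_mult)
    also have "\<dots> \<le> a powr (\<mu> - 1) * norm (w' p) + S * ((1 - \<mu>) * p powr (\<mu> - 2))"
      using \<mu> by (intro add_mono mult_right_mono powr_le S p) auto
    finally show "norm (g' p) \<le> a powr (\<mu> - 1) * norm (w' p) + S * - ((\<mu> - 1) * p powr (\<mu> - 2))"
      by (simp add: algebra_simps)
  qed
  also have "\<dots> = a powr (\<mu> - 1) * integral {a..b} (\<lambda>p. norm (w' p)) + S * - (b powr (\<mu> - 1) - a powr (\<mu> - 1))"
    using integral_unique[OF powr_int] has_integral_integrable[OF powr_int]
    by (subst Henstock_Kurzweil_Integration.integral_add) (auto intro: integrable_on_mult_right w'n)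
  also have "\<dots> \<le> a powr (\<mu> - 1) * V + S * a powr (\<mu> - 1)"
    using V S0 by (intro add_mono mult_left_mono) auto
  finally have T: "integral {a..b} (\<lambda>p. norm (g' p)) \<le> a powr (\<mu> - 1) * (S + V)"
    by (simp add: algebra_simps)
  have S': "norm (g p) \<le> a powr (\<mu> - 1) * S" if "p \<in> {a..b}" for p
    using powr_le[OF that] S[OF that] S0 by (simp add: g_def norm_mult mult_mono)
  have "norm (integral {a..b} (\<lambda>p. g p * cis (- \<theta> p)))
    \<le> 2 * \<delta> * (a powr (\<mu> - 1) * S) + 2 * (2 * (a powr (\<mu> - 1) * S) + a powr (\<mu> - 1) * (S + V)) / (L * \<delta>)"
    by (rule van_der_corput[OF ab(2) \<theta> \<theta>1 \<theta>2 L \<delta> g_der g'_abs S' T])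
  also have "\<dots> = a powr (\<mu> - 1) * (2 * \<delta> * S + 2 * (3 * S + V) / (L * \<delta>))"
    using L \<delta> by (simp add: field_simps)
  finally show ?thesis by (simp add: g_def[abs_def])
qed

section \<open>Dispersive estimate on a half-line\<close>

text \<open>The mean value theorem for \<open>x powr (- s)\<close> between \<open>x - 1\<close> and
  \<open>x\<close> bounds each term by a difference that telescopes. With \<open>N \<ge> 2\<close>
  the first telescoped value, a negative power of \<open>N - 1\<close>, is at most 1, so the bound
  is uniform in \<open>N\<close> and \<open>k\<close>.\<close>

lemma sum_powr_le:
  fixes s :: real and N :: nat
  assumes "s > 0" "N \<ge> 2"
  shows "(\<Sum>j<k. (real (N + j)) powr (- s - 1)) \<le> 1 / s"
proof -
  have step: "x powr (- s - 1) \<le> ((x - 1) powr (- s) - x powr (- s)) / s" if x: "x \<ge> 2" for x :: real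
  proof -
    have "\<exists>z>x - 1. z < x \<and> x powr (- s) - (x - 1) powr (- s) = (x - (x - 1)) * (- s * z powr (- s - 1))"
      using x by (intro MVT2) (auto intro!: derivative_eq_intros)
    then obtain z where z: "x - 1 < z" "z < x" "x powr (- s) - (x - 1) powr (- s) = - s * z powr (- s - 1)"
      by auto
    have "x powr (- s - 1) \<le> z powr (- s - 1)"
      using z x assms by (intro powr_mono2') auto
    also have "\<dots> = ((x - 1) powr (- s) - x powr (- s)) / s"
      using z(3) assms by (simp add: field_simps)
    finally show ?thesis .
  qed
  have "(\<Sum>j<k. (real (N + j)) powr (- s - 1))
      \<le> ((real N - 1) powr (- s) - (real (N + k) - 1) powr (- s)) / s"
  proof (induction k)
    case (Suc k)
    have "(real (N + k)) powr (- s - 1) \<le> ((real (N + k) - 1) powr (- s) - (real (N + k)) powr (- s)) / s"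
      using assms by (intro step) simp
    with Suc show ?case by (simp add: diff_divide_distrib)
  qed simp
  also have "\<dots> \<le> 1 / s"
  proof (rule divide_right_mono)
    have "(real N - 1) powr (- s) \<le> 1 powr (- s)"
      using assms by (intro powr_mono2') auto
    then show "(real N - 1) powr (- s) - (real (N + k) - 1) powr (- s) \<le> 1"
      using powr_ge_zero[of "real (N + k) - 1" "- s"] by (simp del: powr_ge_zero)
  qed (use assms in simp)
  finally show ?thesis .
qed

text \<open>The interval is cut at \<open>\<delta>\<close> and at every integer from
  \<open>N\<close> on. The phase is abstract, constrained through lower bounds on
  \<open>\<theta>2\<close>, so that one proof serves the right half-line and the reflected left one.
  The bound does not involve \<open>K\<close>, which can then tend to infinity.\<close>

lemma dispersive_half_line:
  fixes w w' :: "real \<Rightarrow> complex" and \<theta> \<theta>1 \<theta>2 :: "real \<Rightarrow> real" and N K :: nat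
  assumes t: "t \<ge> 1" and N: "2 \<le> N" "N \<le> K" and \<mu>: "0 < \<mu>" "\<mu> \<le> 1"
    and \<beta>: "0 < \<beta>" "\<mu> + \<beta> < \<alpha>" and a: "a > 0" and c: "c > 0"
    and \<theta>: "\<And>p. (\<theta> has_real_derivative \<theta>1 p) (at p)"
    and \<theta>1: "\<And>p. (\<theta>1 has_real_derivative \<theta>2 p) (at p)"
    and \<theta>2: "continuous_on UNIV \<theta>2"
    and \<theta>2_near: "\<And>p. 0 \<le> p \<Longrightarrow> p \<le> real N \<Longrightarrow> t * a \<le> \<theta>2 p"
    and \<theta>2_far: "\<And>p. real N \<le> p \<Longrightarrow> t * (c * p powr (- \<beta>)) \<le> \<theta>2 p"
    and w: "\<And>p. (w has_vector_derivative w' p) (at p)"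
    and w': "\<And>x y. w' absolutely_integrable_on {x..y}"
    and w_near: "\<And>p. 0 \<le> p \<Longrightarrow> p \<le> real N \<Longrightarrow> norm (w p) \<le> A"
    and w'_near: "integral {0..real N} (\<lambda>p. norm (w' p)) \<le> V"
    and w_far: "\<And>p. real N \<le> p \<Longrightarrow> norm (w p) \<le> M * p powr (- \<alpha>)"
    and w'_far: "\<And>n. N \<le> n \<Longrightarrow> integral {real n..real n + 1} (\<lambda>p. norm (w' p)) \<le> M' * real n powr (- \<alpha>)"
    and M: "0 \<le> M" "0 \<le> M'"
    and int: "(\<lambda>p. of_real (p powr (\<mu> - 1)) * w p * cis (- \<theta> p)) integrable_on {0..real K}"
  shows "norm (integral {0..real K} (\<lambda>p. of_real (p powr (\<mu> - 1)) * w p * cis (- \<theta> p)))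
    \<le> (4 / \<mu> * A + 2 / a * (3 * A + V)) * t powr (- \<mu> / 2)
      + (2 * M / (\<alpha> - \<mu>) + 2 * 2 powr \<beta> * (3 * M + M') / (c * (\<alpha> - \<mu> - \<beta>))) * t powr (- 1 / 2)"
proof -
  define G where "G p = of_real (p powr (\<mu> - 1)) * w p * cis (- \<theta> p)" for p
  \<comment> \<open>The window costs a multiple of \<open>\<delta>\<close>, the integration by parts
    a multiple of \<open>1 / (t * \<delta>)\<close>; this choice makes the two equal.
    \<open>t \<ge> 1\<close> ensures that the cut lies before \<open>N\<close>.\<close>
  define \<delta> where "\<delta> = t powr (- 1 / 2)"
  have \<delta>: "0 < \<delta>" "\<delta> \<le> 1" "\<delta> \<le> real N"
  proof -
    show "0 < \<delta>" using t by (simp add: \<delta>_def)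
    have "\<delta> \<le> t powr 0" unfolding \<delta>_def using t by (intro powr_mono) auto
    then show "\<delta> \<le> 1" using t by simp
    then show "\<delta> \<le> real N" using N by simp
  qed
  have t\<delta>: "t * \<delta> = 1 / \<delta>"
  proof -
    have "t * \<delta> * \<delta> = t powr (1 + (- 1 / 2) + (- 1 / 2))"
      unfolding powr_add \<delta>_def using t by simp
    then show ?thesis using \<delta> t by (simp add: field_simps)
  qed
  have t\<delta>_mult: "t * x * \<delta> = x / \<delta>" for x
  proof -
    have "t * x * \<delta> = x * (t * \<delta>)" by simp
    then show ?thesis unfolding t\<delta> by simp
  qed
  have \<delta>\<mu>: "\<delta> powr \<mu> = t powr (- \<mu> / 2)"
    unfolding \<delta>_def by (simp add: powr_powr)
  have A0: "0 \<le> A" using order_trans[OF norm_ge_zero w_near[of 0]] by simp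
  have int_sub: "G integrable_on {x..y}" if "0 \<le> x" "y \<le> real K" for x y
    using int that by (auto simp: G_def[abs_def] intro: integrable_on_subinterval)
  have w'n: "(\<lambda>p. norm (w' p)) integrable_on {x..y}" for x y
    using w'[of x y] by (simp add: absolutely_integrable_on_def)

  \<comment> \<open>Next to the singularity the oscillation is ignored; the weight is integrable
    there because \<open>\<mu> > 0\<close>.\<close>
  have near0: "norm (integral {0..\<delta>} G) \<le> A / \<mu> * \<delta> powr \<mu>"
  proof -
    have hi: "((\<lambda>p. A * p powr (\<mu> - 1)) has_integral A * (\<delta> powr (\<mu> - 1 + 1) / (\<mu> - 1 + 1))) {0..\<delta>}"
      using \<mu> \<delta> by (intro has_integral_mult_right has_integral_powr_from_0) auto
    have "norm (integral {0..\<delta>} G) \<le> integral {0..\<delta>} (\<lambda>p. A * p powr (\<mu> - 1))"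
    proof (rule Henstock_Kurzweil_Integration.integral_norm_bound_integral[OF int_sub has_integral_integrable[OF hi]])
      show "norm (G p) \<le> A * p powr (\<mu> - 1)" if "p \<in> {0..\<delta>}" for p
        using mult_right_mono[OF w_near[of p], of "p powr (\<mu> - 1)"] that \<delta>
        by (simp add: G_def norm_mult mult.commute)
    qed (use \<delta> N in auto)
    also have "\<dots> = A / \<mu> * \<delta> powr \<mu>" using integral_unique[OF hi] by simp
    finally show ?thesis .
  qed

  \<comment> \<open>The weight at the left endpoint is \<open>\<delta> powr (\<mu> - 1)\<close> and
    the remaining factor is of order \<open>\<delta>\<close>, so this piece has the same order as
    the singular one.\<close>
  have near: "norm (integral {\<delta>..real N} G) \<le> (2 * A + 2 / a * (3 * A + V)) * \<delta> powr \<mu>"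
  proof -
    have "integral {\<delta>..real N} (\<lambda>p. norm (w' p)) \<le> integral {0..real N} (\<lambda>p. norm (w' p))"
      using \<delta> by (intro integral_subset_le w'n) auto
    then have "norm (integral {\<delta>..real N} G)
        \<le> \<delta> powr (\<mu> - 1) * (2 * \<delta> * A + 2 * (3 * A + V) / (t * a * \<delta>))"
      unfolding G_def[abs_def] using \<delta> \<mu> \<theta> \<theta>1 w w' t a w'_near
      by (intro van_der_corput_powr[of \<delta> "real N" \<mu> \<theta> \<theta>1 \<theta>2 "t * a" \<delta> w w'])
        (auto intro: continuous_on_subset[OF \<theta>2] \<theta>2_near w_near)
    also have "2 * (3 * A + V) / (t * a * \<delta>) = \<delta> * (2 / a * (3 * A + V))"
      unfolding t\<delta>_mult by simp
    also have "\<delta> powr (\<mu> - 1) * (2 * \<delta> * A + \<delta> * (2 / a * (3 * A + V)))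
      = (\<delta> powr (\<mu> - 1) * \<delta>) * (2 * A + 2 / a * (3 * A + V))" by (simp add: algebra_simps)
    also have "\<delta> powr (\<mu> - 1) * \<delta> = \<delta> powr \<mu>"
      using \<delta> by (simp add: powr_diff)
    finally show ?thesis by (simp add: mult.commute)
  qed

  define D where "D = 2 * 2 powr \<beta> * (3 * M + M') / c"
  \<comment> \<open>On this interval \<open>p \<le> 2 * n\<close>, which is the source of
    \<open>2 powr \<beta>\<close>. The window term is of size
    \<open>n powr (\<mu> - 1 - \<alpha>)\<close>, and division by the curvature loses a further
    \<open>n powr \<beta>\<close>. Both exponents stay below -1 because
    \<open>\<mu> + \<beta> < \<alpha>\<close>, so the pieces can be summed.\<close>
  have far_piece: "norm (integral {real n..real n + 1} G)
      \<le> \<delta> * (2 * M * real n powr (- (\<alpha> - \<mu>) - 1) + D * real n powr (- (\<alpha> - \<mu> - \<beta>) - 1))"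
    if n: "N \<le> n" for n
  proof -
    have n2: "2 \<le> real n" using n N by simp
    define L where "L = c * (2 * real n) powr (- \<beta>)"
    have L0: "L > 0" using c n2 by (simp add: L_def)
    have "t * L \<le> \<theta>2 p" if p: "p \<in> {real n..real n + 1}" for p
    proof -
      have "(2 * real n) powr (- \<beta>) \<le> p powr (- \<beta>)"
        using p n2 \<beta> by (intro powr_mono2') auto
      then have "t * L \<le> t * (c * p powr (- \<beta>))"
        unfolding L_def using c t by (intro mult_left_mono) auto
      also have "\<dots> \<le> \<theta>2 p" using p n by (intro \<theta>2_far) auto
      finally show ?thesis .
    qed
    moreover have "norm (w p) \<le> M * real n powr (- \<alpha>)" if p: "p \<in> {real n..real n + 1}" for p
    proof -
      have "norm (w p) \<le> M * p powr (- \<alpha>)" using p n by (intro w_far) auto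
      also have "\<dots> \<le> M * real n powr (- \<alpha>)"
        using p n2 \<beta> \<mu> M by (intro mult_left_mono powr_mono2') auto
      finally show ?thesis .
    qed
    ultimately have "norm (integral {real n..real n + 1} G) \<le> real n powr (\<mu> - 1)
      * (2 * \<delta> * (M * real n powr (- \<alpha>))
        + 2 * (3 * (M * real n powr (- \<alpha>)) + M' * real n powr (- \<alpha>)) / (t * L * \<delta>))"
      unfolding G_def[abs_def] using n2 n \<delta> \<mu> \<theta> \<theta>1 w w' t L0
      by (intro van_der_corput_powr[of "real n" "real n + 1" \<mu> \<theta> \<theta>1 \<theta>2 "t * L" \<delta> w w'])
        (auto intro: continuous_on_subset[OF \<theta>2] w'_far)
    also have "\<dots> = \<delta> * (real n powr (\<mu> - 1) * real n powr (- \<alpha>)) * (2 * M + 2 * (3 * M + M') * (1 / L))"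
    proof -
      have "2 * (3 * (M * real n powr (- \<alpha>)) + M' * real n powr (- \<alpha>)) / (t * L * \<delta>)
          = 2 * (3 * (M * real n powr (- \<alpha>)) + M' * real n powr (- \<alpha>)) * \<delta> * (1 / L)"
        unfolding t\<delta>_mult by simp
      then show ?thesis by (simp add: algebra_simps)
    qed
    also have "1 / L = 2 powr \<beta> / c * real n powr \<beta>"
      using n2 by (simp add: L_def powr_mult powr_minus field_simps)
    also have "real n powr (\<mu> - 1) * real n powr (- \<alpha>) = real n powr (- (\<alpha> - \<mu>) - 1)"
      by (simp flip: powr_add add: algebra_simps)
    also have "\<delta> * real n powr (- (\<alpha> - \<mu>) - 1) * (2 * M + 2 * (3 * M + M') * (2 powr \<beta> / c * real n powr \<beta>))
      = \<delta> * (2 * M * real n powr (- (\<alpha> - \<mu>) - 1) + D * (real n powr (- (\<alpha> - \<mu>) - 1) * real n powr \<beta>))"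
      by (simp add: D_def algebra_simps)
    also have "real n powr (- (\<alpha> - \<mu>) - 1) * real n powr \<beta> = real n powr (- (\<alpha> - \<mu> - \<beta>) - 1)"
      by (simp flip: powr_add add: algebra_simps)
    finally show ?thesis .
  qed

  have far_sum: "norm (integral {real N..real (N + k)} G)
      \<le> \<delta> * (2 * M * (\<Sum>j<k. real (N + j) powr (- (\<alpha> - \<mu>) - 1))
        + D * (\<Sum>j<k. real (N + j) powr (- (\<alpha> - \<mu> - \<beta>) - 1)))"
    if "N + k \<le> K" for k
    using that
  proof (induction k)
    case (Suc k)
    have "integral {real N..real (N + Suc k)} G
        = integral {real N..real (N + k)} G + integral {real (N + k)..real (N + k) + 1} G"
      using Henstock_Kurzweil_Integration.integral_combine[of "real N" "real (N + k)" "real (N + Suc k)" G]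
        int_sub[of "real N" "real (N + Suc k)"] Suc.prems by (simp add: add_ac)
    also have "norm \<dots> \<le> norm (integral {real N..real (N + k)} G) + norm (integral {real (N + k)..real (N + k) + 1} G)"
      by (rule norm_triangle_ineq)
    also have "\<dots> \<le> \<delta> * (2 * M * (\<Sum>j<k. real (N + j) powr (- (\<alpha> - \<mu>) - 1))
        + D * (\<Sum>j<k. real (N + j) powr (- (\<alpha> - \<mu> - \<beta>) - 1)))
      + \<delta> * (2 * M * real (N + k) powr (- (\<alpha> - \<mu>) - 1) + D * real (N + k) powr (- (\<alpha> - \<mu> - \<beta>) - 1))"
      using Suc by (intro add_mono far_piece) auto
    finally show ?case by (simp add: algebra_simps)
  qed simp
  have D0: "0 \<le> D" using M c by (simp add: D_def)
  have "norm (integral {real N..real K} G)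
      \<le> \<delta> * (2 * M * (\<Sum>j<K - N. real (N + j) powr (- (\<alpha> - \<mu>) - 1))
        + D * (\<Sum>j<K - N. real (N + j) powr (- (\<alpha> - \<mu> - \<beta>) - 1)))"
    using far_sum[of "K - N"] N by simp
  also have "\<dots> \<le> \<delta> * (2 * M * (1 / (\<alpha> - \<mu>)) + D * (1 / (\<alpha> - \<mu> - \<beta>)))"
    using \<delta> M D0 \<beta> N by (intro mult_left_mono add_mono sum_powr_le) auto
  finally have far: "norm (integral {real N..real K} G)
      \<le> (2 * M / (\<alpha> - \<mu>) + 2 * 2 powr \<beta> * (3 * M + M') / (c * (\<alpha> - \<mu> - \<beta>))) * \<delta>"
    by (simp add: D_def mult.commute)

  have split: "integral {0..real K} G
      = integral {0..\<delta>} G + integral {\<delta>..real N} G + integral {real N..real K} G"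
    using Henstock_Kurzweil_Integration.integral_combine[of 0 "real N" "real K" G]
      Henstock_Kurzweil_Integration.integral_combine[of 0 \<delta> "real N" G] int_sub \<delta> N by simp
  \<comment> \<open>The singular piece brings \<open>1 / \<mu>\<close>, the window \<open>2\<close>,
    which is at most \<open>3 / \<mu>\<close>; together they make \<open>4 / \<mu>\<close>.\<close>
  have "A / \<mu> * \<delta> powr \<mu> + (2 * A + 2 / a * (3 * A + V)) * \<delta> powr \<mu>
      \<le> (4 / \<mu> * A + 2 / a * (3 * A + V)) * \<delta> powr \<mu>"
  proof -
    have "2 * A \<le> 3 / \<mu> * A"
      using A0 \<mu> by (intro mult_right_mono) (auto simp: field_simps)
    moreover have "4 / \<mu> * A = A / \<mu> + 3 / \<mu> * A" using \<mu> by (simp add: field_simps)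
    ultimately have "A / \<mu> + (2 * A + 2 / a * (3 * A + V)) \<le> 4 / \<mu> * A + 2 / a * (3 * A + V)"
      by linarith
    from mult_right_mono[OF this, of "\<delta> powr \<mu>"] show ?thesis by (simp add: distrib_right)
  qed
  with near0 near far have "norm (integral {0..real K} G)
    \<le> (4 / \<mu> * A + 2 / a * (3 * A + V)) * \<delta> powr \<mu>
      + (2 * M / (\<alpha> - \<mu>) + 2 * 2 powr \<beta> * (3 * M + M') / (c * (\<alpha> - \<mu> - \<beta>))) * \<delta>"
    unfolding split
    using norm_triangle_ineq[of "integral {0..\<delta>} G + integral {\<delta>..real N} G" "integral {real N..real K} G"]
      norm_triangle_ineq[of "integral {0..\<delta>} G" "integral {\<delta>..real N} G"] by linarith
  then show ?thesis unfolding \<delta>\<mu> by (simp add: G_def[abs_def] \<delta>_def)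
qed

section \<open>Essential suprema, L1 norms and attained minima\<close>

text \<open>For continuous \<open>w\<close> an almost-everywhere bound defines a closed set, which
  must contain the whole open interval and hence its closure. Boundedness excludes an infinite
  essential supremum, which \<open>real_of_ereal\<close> would send to 0. The endpoints matter
  because the half-line estimate works on closed intervals.\<close>

lemma norm_le_Linf_norm:
  fixes w :: "real \<Rightarrow> complex"
  assumes cont: "continuous_on UNIV w" and bdd: "bounded (range w)"
    and ab: "a < b" and p: "p \<in> {a..b}"
  shows "norm (w p) \<le> real_of_ereal (Linf_norm {a<..<b} w)"
proof -
  define E where "E = Linf_norm {a<..<b} w"
  obtain B where B: "\<And>x. norm (w x) \<le> B"
    using bdd by (auto simp: bounded_iff)
  have meas: "(\<lambda>x. ereal (norm (w x))) \<in> borel_measurable (lebesgue_on {a<..<b})"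
    by (intro borel_measurable_ereal continuous_imp_measurable_on_sets_lebesgue
        continuous_on_norm continuous_on_subset[OF cont]) auto
  have "E \<le> ereal B"
    unfolding E_def Linf_norm_def using B by (intro esssup_I meas) auto
  then have fin: "x \<le> real_of_ereal E" if "ereal x \<le> E" for x
    using that by (cases E) auto
  have "AE x in lebesgue_on {a<..<b}. ereal (norm (w x)) \<le> E"
    unfolding E_def Linf_norm_def by (rule esssup_AE)
  then have "AE x in lebesgue_on {a<..<b}. norm (w x) \<le> real_of_ereal E"
    by eventually_elim (rule fin)
  then have ae: "AE x in lebesgue. x \<in> {a<..<b} \<longrightarrow> norm (w x) \<le> real_of_ereal E"
    by (subst (asm) AE_restrict_space_iff) auto
  have closed: "closed {x. norm (w x) \<le> real_of_ereal E}"
    using cont by (intro closed_Collect_le continuous_intros)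
  have "norm (w x) \<le> real_of_ereal E" if "x \<in> {a<..<b}" for x
    using mem_closed_if_AE_lebesgue_open[OF _ closed _ that] ae by auto
  then show ?thesis
    unfolding E_def[symmetric] using ab p cont
    by (intro continuous_on_closure_norm_le[of "{a<..<b}"]) (auto intro: continuous_on_subset)
qed

lemma L1_norm_eq_integral:
  assumes "g absolutely_integrable_on {a..b}"
  shows "L1_norm {a<..<b} g = integral {a..b} (\<lambda>p. norm (g p))"
proof -
  have "set_integrable lebesgue {a<..<b} (\<lambda>p. norm (g p))"
    using assms by (intro set_integrable_norm set_integrable_subset[OF assms]) auto
  then show ?thesis
    unfolding L1_norm_def integral_open_interval_real
    by (rule set_lebesgue_integral_eq_integral(2))
qed

text \<open>Compactness makes the minimum attained, which is what gives \<open>LEAST\<close> its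
  intended meaning over the reals.\<close>

lemma Least_image_Icc:
  fixes F :: "real \<Rightarrow> real"
  assumes "a \<le> b" "continuous_on {a..b} F"
  shows "(LEAST y. y \<in> F ` {a..b}) \<in> F ` {a..b}"
    and "p \<in> {a..b} \<Longrightarrow> (LEAST y. y \<in> F ` {a..b}) \<le> F p"
proof -
  obtain x where x: "x \<in> {a..b}" "\<And>y. y \<in> {a..b} \<Longrightarrow> F x \<le> F y"
    using continuous_attains_inf[of "{a..b}" F] assms by auto
  then have "(LEAST y. y \<in> F ` {a..b}) = F x"
    by (intro Least_equality) auto
  with x show "(LEAST y. y \<in> F ` {a..b}) \<in> F ` {a..b}"
    and "p \<in> {a..b} \<Longrightarrow> (LEAST y. y \<in> F ` {a..b}) \<le> F p"
    by auto
qed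

section \<open>Lebesgue and Fourier integrals over the whole line\<close>

text \<open>Dominated convergence, with \<open>norm (G x)\<close> as dominating function. This links
  the gauge integrals on compact intervals, where the estimates are made, to the Lebesgue integral
  in the formula for \<open>u\<close>.\<close>

lemma norm_lebesgue_integral_le_truncations:
  fixes G :: "real \<Rightarrow> complex"
  assumes G: "integrable lebesgue G"
    and le: "\<And>K::nat. N \<le> K \<Longrightarrow> norm (integral {- real K..real K} G) \<le> B"
  shows "norm (integral\<^sup>L lebesgue G) \<le> B"
proof -
  have G_abs: "G absolutely_integrable_on {- real K..real K}" for K
    using G by (auto simp: set_integrable_def intro: integrable_mult_indicator)
  have "(\<lambda>K. LINT x|lebesgue. indicator {- real K..real K} x *\<^sub>R G x) \<longlonglongrightarrow> integral\<^sup>L lebesgue G"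
  proof (rule integral_dominated_convergence[where w = "\<lambda>x. norm (G x)"])
    show "integrable lebesgue (\<lambda>x. norm (G x))" using G by simp
    show "AE x in lebesgue. (\<lambda>K. indicat_real {- real K..real K} x *\<^sub>R G x) \<longlonglongrightarrow> G x"
    proof (rule AE_I2)
      fix x
      obtain k :: nat where k: "\<bar>x\<bar> \<le> real k" using real_arch_simple by blast
      have "\<forall>\<^sub>F K in sequentially. indicat_real {- real K..real K} x *\<^sub>R G x = G x"
        using eventually_ge_at_top[of k] by eventually_elim (use k in \<open>auto simp: indicator_def\<close>)
      then show "(\<lambda>K. indicat_real {- real K..real K} x *\<^sub>R G x) \<longlonglongrightarrow> G x"
        by (rule tendsto_eventually)
    qed
    show "(\<lambda>x. indicat_real {- real K..real K} x *\<^sub>R G x) \<in> borel_measurable lebesgue" for K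
      using G_abs[of K] by (simp add: set_integrable_def)
    show "AE x in lebesgue. norm (indicat_real {- real K..real K} x *\<^sub>R G x) \<le> norm (G x)" for K
      by (auto simp: indicator_def)
  qed (use G in auto)
  then have "(\<lambda>K. integral {- real K..real K} G) \<longlonglongrightarrow> integral\<^sup>L lebesgue G"
    using set_lebesgue_integral_eq_integral(2)[OF G_abs] by (simp add: set_lebesgue_integral_def)
  then show ?thesis
    using le by (intro Lim_norm_ubound[of sequentially]) (auto simp: eventually_sequentially)
qed

text \<open>The factor has modulus one and its inverse has the same form, so one implication, used
  with \<open>x\<close> and with \<open>- x\<close>, gives both directions.\<close>

lemma integrable_cis_mult_iff:
  fixes H :: "real \<Rightarrow> complex"
  shows "integrable lebesgue (\<lambda>p. H p * cis (x * p)) \<longleftrightarrow> integrable lebesgue H"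
proof
  have cis_meas: "(\<lambda>p. cis (y * p)) \<in> borel_measurable lebesgue" for y
    using continuous_imp_measurable_on_sets_lebesgue[of UNIV "\<lambda>p. cis (y * p)"]
    by (simp add: continuous_intros)
  have *: "integrable lebesgue (\<lambda>p. H p * cis (y * p))" if "integrable lebesgue H" for H :: "real \<Rightarrow> complex" and y
    using that cis_meas
    by (intro Bochner_Integration.integrable_bound[OF that]) (auto simp: norm_mult intro: borel_measurable_times)
  show "integrable lebesgue (\<lambda>p. H p * cis (x * p))" if "integrable lebesgue H"
    by (rule *[OF that])
  show "integrable lebesgue H" if "integrable lebesgue (\<lambda>p. H p * cis (x * p))"
    using *[OF that, of "- x"] by (simp add: mult.assoc cis_mult)
qed

text \<open>Dominated convergence again: the modulus of the integrand is independent of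
  \<open>x\<close>. Its purpose is the measurability of \<open>u t\<close>.\<close>

lemma continuous_on_fourier_integral:
  fixes H :: "real \<Rightarrow> complex"
  assumes "integrable lebesgue H"
  shows "continuous_on UNIV (\<lambda>x. LINT p|lebesgue. H p * cis (x * p))"
  unfolding continuous_on_sequentially
proof (intro allI ballI impI)
  fix X and x :: real
  assume X: "(\<forall>n. X n \<in> UNIV) \<and> X \<longlonglongrightarrow> x"
  show "((\<lambda>x. LINT p|lebesgue. H p * cis (x * p)) \<circ> X) \<longlonglongrightarrow> (LINT p|lebesgue. H p * cis (x * p))"
    unfolding comp_def
  proof (rule integral_dominated_convergence[where w = "\<lambda>x. norm (H x)"])
    have "(\<lambda>p. H p * cis (y * p)) \<in> borel_measurable lebesgue" for y
      using assms integrable_cis_mult_iff[of H y] borel_measurable_integrable by blast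
    then show "(\<lambda>p. H p * cis (x * p)) \<in> borel_measurable lebesgue"
      "(\<lambda>p. H p * cis (X n * p)) \<in> borel_measurable lebesgue" for n
      by blast+
    show "AE p in lebesgue. (\<lambda>n. H p * cis (X n * p)) \<longlonglongrightarrow> H p * cis (x * p)"
      using X by (intro AE_I2 tendsto_intros) auto
  qed (use assms in \<open>auto simp: norm_mult\<close>)
qed

section \<open>Derivatives of \<open>f\<close> and comparison of the constants\<close>

lemma smooth_real_derivatives:
  fixes f :: "real \<Rightarrow> real"
  assumes "smooth f"
  shows "(f has_real_derivative deriv f p) (at p)"
    and "(deriv f has_real_derivative deriv (deriv f) p) (at p)"
    and "continuous_on S (deriv (deriv f))"
proof -
  have d: "(deriv ^^ k) f differentiable (at x)" for k x
    using assms by (simp add: smooth_def nth_deriv_real)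
  from d[of 0] show "(f has_real_derivative deriv f p) (at p)"
    by (simp add: DERIV_deriv_iff_real_differentiable)
  from d[of 1] show "(deriv f has_real_derivative deriv (deriv f) p) (at p)"
    by (simp add: DERIV_deriv_iff_real_differentiable)
  from d[of 2] show "continuous_on S (deriv (deriv f))"
    by (intro differentiable_imp_continuous_on differentiable_at_imp_differentiable_on)
      (simp add: numeral_2_eq_2)
qed

text \<open>The left side is what two half-lines contribute under the prefactor
  \<open>1 / (2 * pi)\<close>. The comparison is termwise: powers of 2 with nonnegative exponents
  are at least 1, \<open>\<beta> \<le> 1 - \<mu> + 2 * \<beta>\<close>, and the numerators
  \<open>\<alpha> + 1 - \<mu>\<close> and \<open>\<alpha> + 1 - \<mu> - \<beta>\<close> exceed
  1.\<close>

lemma const2_ge: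
  fixes \<alpha> \<mu> \<beta> c M M' :: real
  assumes \<mu>: "0 < \<mu>" "\<mu> \<le> 1" and \<beta>: "0 < \<beta>" "\<mu> + \<beta> < \<alpha>" and c: "c > 0" and M: "0 \<le> M" "0 \<le> M'"
  shows "1 / pi * (2 * M / (\<alpha> - \<mu>) + 2 * 2 powr \<beta> * (3 * M + M') / (c * (\<alpha> - \<mu> - \<beta>)))
    \<le> const2 \<alpha> \<mu> \<beta> c M M'"
proof -
  have powr_ge_1: "1 \<le> 2 powr x" if "0 \<le> x" for x :: real
    using that by (rule ge_one_powr_ge_zero[rotated]) simp
  have "2 * (M / pi) * (1 / (\<alpha> - \<mu>)) \<le> 5 * (2 powr (\<alpha> - \<mu> + 1) * M / pi) * ((\<alpha> + 1 - \<mu>) / (\<alpha> - \<mu>))"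
  proof (rule mult_mono)
    have "1 * (M / pi) \<le> 2 powr (\<alpha> - \<mu> + 1) * (M / pi)"
      using powr_ge_1[of "\<alpha> - \<mu> + 1"] \<beta> M by (intro mult_right_mono) auto
    then show "2 * (M / pi) \<le> 5 * (2 powr (\<alpha> - \<mu> + 1) * M / pi)"
      using divide_nonneg_pos[OF M(1) pi_gt_zero] by simp
  qed (use \<beta> M in \<open>auto simp: divide_right_mono\<close>)
  moreover have "2 * (2 powr \<beta> * (3 * M + M') / (pi * c)) * (1 / (\<alpha> - \<mu> - \<beta>))
    \<le> 3 * (2 powr (1 - \<mu> + 2 * \<beta>) * (5 * 2 powr \<alpha> * M + M') / (pi * c)) * ((\<alpha> + 1 - \<mu> - \<beta>) / (\<alpha> - \<mu> - \<beta>))"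
  proof (intro mult_mono divide_right_mono)
    show "(2::real) powr \<beta> \<le> 2 powr (1 - \<mu> + 2 * \<beta>)" using \<mu> \<beta> by (intro powr_mono) auto
    have "3 * M \<le> 5 * 2 powr \<alpha> * M"
      using powr_ge_1[of \<alpha>] \<mu> \<beta> M by (intro mult_right_mono) auto
    then show "3 * M + M' \<le> 5 * 2 powr \<alpha> * M + M'" by simp
  qed (use \<beta> M c in auto)
  moreover have "1 / pi * (2 * M / (\<alpha> - \<mu>) + 2 * 2 powr \<beta> * (3 * M + M') / (c * (\<alpha> - \<mu> - \<beta>)))
    = 2 * (M / pi) * (1 / (\<alpha> - \<mu>)) + 2 * (2 powr \<beta> * (3 * M + M') / (pi * c)) * (1 / (\<alpha> - \<mu> - \<beta>))"
    by (simp add: distrib_left add_divide_distrib mult.assoc)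
  ultimately show ?thesis
    unfolding const2_def by linarith
qed

text \<open>\<open>deriv f\<close> is strictly increasing, so the two increments inverted in each
  definition are positive.\<close>

lemma m_plus_minus_ge:
  fixes f :: "real \<Rightarrow> real"
  assumes "smooth f" "\<And>p. deriv (deriv f) p > 0"
  shows "2 / (LEAST y. y \<in> deriv (deriv f) ` {0..of_int N}) \<le> m_plus f N"
    and "2 / (LEAST y. y \<in> deriv (deriv f) ` {- of_int N..0}) \<le> m_minus f N"
proof -
  have less: "deriv f x < deriv f y" if "x < y" for x y
    by (rule DERIV_pos_imp_increasing[OF that]) (use assms(2) smooth_real_derivatives(2)[OF assms(1)] in blast)
  show "2 / (LEAST y. y \<in> deriv (deriv f) ` {0..of_int N}) \<le> m_plus f N"
    using less[of "of_int N" "of_int N + 1"] less[of "- 1" 0]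
    by (simp add: m_plus_def divide_inverse add_nonneg_nonneg)
  show "2 / (LEAST y. y \<in> deriv (deriv f) ` {- of_int N..0}) \<le> m_minus f N"
    using less[of "- of_int N - 1" "- of_int N"] less[of 0 1]
    by (simp add: m_minus_def divide_inverse add_nonneg_nonneg)
qed

section \<open>Decay in time of the solution, uniformly in space\<close>

theorem theorem2p10:
  fixes f :: "real \<Rightarrow> real"
    and R \<beta> c \<mu> \<alpha> r M M' :: real
    and u0 :: "(real \<Rightarrow> complex) \<Rightarrow> complex"
    and Fu0 :: "real \<Rightarrow> complex"
    and w :: "real \<Rightarrow> complex"
    and u :: "real \<Rightarrow> real \<Rightarrow> complex"
  assumes f_smooth: "smooth f"
    and f_growth: "\<And>k. polynomial_growth (nth_deriv k f)"
    and f_convex: "\<And>p. deriv (deriv f) p > 0"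
    and R: "R > 0" and \<beta>: "\<beta> > 0" and c: "c > 0"
    and f_lower: "\<And>p. \<bar>p\<bar> \<ge> R \<Longrightarrow> c * \<bar>p\<bar> powr (- \<beta>) \<le> deriv (deriv f) p"
    and \<mu>: "0 < \<mu>" "\<mu> \<le> 1"
    and \<alpha>: "\<alpha> > \<mu> + \<beta>"
    and r: "0 \<le> r" "r \<le> R"
    and u0: "tempered_distribution u0"
    and Fu0: "distr_is_function (fourier_distr u0) Fu0"
    and w_bounded: "bounded (range w)"
    and w_diff: "\<And>p. w differentiable (at p)"
    and w_0: "\<mu> \<noteq> 1 \<Longrightarrow> w 0 \<noteq> 0"
    and Fu0_eq: "\<And>p. p \<noteq> 0 \<Longrightarrow> Fu0 p = of_real (\<bar>p\<bar> powr (\<mu> - 1)) * w p"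
    and M: "M \<ge> 0"
    and w_decay: "\<And>p. norm (w p) \<le> M * (1 + p\<^sup>2) powr (- \<alpha> / 2)"
    and w'_L1: "locally_L1 (\<lambda>p. vector_derivative w (at p))"
    and M': "M' \<ge> 0"
    and w'_decay: "\<And>n::int. n \<noteq> 0 \<Longrightarrow> \<bar>of_int n\<bar> \<ge> r \<Longrightarrow>
          L1_norm {of_int n<..<of_int n + 1} (\<lambda>p. vector_derivative w (at p))
            \<le> M' * \<bar>of_int n\<bar> powr (- \<alpha>)"
    and u: "\<And>t x. t > 0 \<Longrightarrow>
          u t x = of_real (1 / (2 * pi)) *
            (LINT p|lebesgue. Fu0 p *
               exp (- \<i> * of_real t * of_real (f p) + \<i> * of_real x * of_real p))"
  shows "\<forall>t\<ge>1. Linf_norm UNIV (u t)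
           \<le> ereal (const1 f w \<mu> R * t powr (- \<mu> / 2)
                    + const2 \<alpha> \<mu> \<beta> c M M' * t powr (- 1 / 2))"
proof (intro allI impI)
  fix t :: real assume t: "1 \<le> t"
  define w' where "w' p = vector_derivative w (at p)" for p
  \<comment> \<open>\<open>R > 0\<close> gives \<open>N \<ge> 2\<close>, as the sums over unit
    intervals require. \<open>R \<le> real N\<close> brings everything beyond \<open>N\<close> under
    the lower bound on the second derivative and, through \<open>r \<le> R\<close>, under the decay
    of \<open>w'\<close>.\<close>
  define N where "N = nat (\<lceil>R\<rceil> + 1)"
  have N_int: "int N = \<lceil>R\<rceil> + 1" and N: "2 \<le> N" "R \<le> real N"
    using R unfolding N_def by linarith+
  have N_real: "of_int (\<lceil>R\<rceil> + 1) = real N" using N_int by (metis of_int_of_nat_eq)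

  have w: "(w has_vector_derivative w' p) (at p)" for p
    using w_diff[of p] by (simp add: w'_def vector_derivative_works)
  have w': "w' absolutely_integrable_on {x..y}" for x y
    using w'_L1 by (simp add: locally_L1_def w'_def[abs_def])
  have w_cont: "continuous_on S w" for S
    using w by (intro continuous_at_imp_continuous_on ballI) (auto intro: has_vector_derivative_continuous)
  have w_le: "norm (w p) \<le> M * \<bar>p\<bar> powr (- \<alpha>)" if "p \<noteq> 0" for p
  proof -
    have "(1 + p\<^sup>2) powr (- \<alpha> / 2) \<le> (p\<^sup>2) powr (- \<alpha> / 2)"
      using that \<alpha> \<mu> \<beta> by (intro powr_mono2') auto
    also have "(p\<^sup>2) powr (- \<alpha> / 2) = (\<bar>p\<bar> powr 2) powr (- \<alpha> / 2)"
      using that by simp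
    also have "\<dots> = \<bar>p\<bar> powr (- \<alpha>)" unfolding powr_powr by simp
    finally show ?thesis using w_decay[of p] M by (meson mult_left_mono order_trans)
  qed

  define Ap where "Ap = real_of_ereal (Linf_norm {0<..<real N} w)"
  define Am where "Am = real_of_ereal (Linf_norm {- real N<..<0} w)"
  define Vp where "Vp = L1_norm {0<..<real N} w'"
  define Vm where "Vm = L1_norm {- real N<..<0} w'"
  define ap where "ap = (LEAST y. y \<in> deriv (deriv f) ` {0..real N})"
  define am where "am = (LEAST y. y \<in> deriv (deriv f) ` {- real N..0})"
  define C2 where "C2 = 2 * M / (\<alpha> - \<mu>) + 2 * 2 powr \<beta> * (3 * M + M') / (c * (\<alpha> - \<mu> - \<beta>))"
  define Bp where "Bp = 4 / \<mu> * Ap + 2 / ap * (3 * Ap + Vp)"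
  define Bm where "Bm = 4 / \<mu> * Am + 2 / am * (3 * Am + Vm)"
  note f_der = smooth_real_derivatives[OF f_smooth]
  have Ap: "norm (w p) \<le> Ap" if "p \<in> {0..real N}" for p
    unfolding Ap_def using N that by (intro norm_le_Linf_norm w_cont w_bounded) auto
  have Am: "norm (w p) \<le> Am" if "p \<in> {- real N..0}" for p
    unfolding Am_def using N that by (intro norm_le_Linf_norm w_cont w_bounded) auto
  have Ap0: "0 \<le> Ap" and Am0: "0 \<le> Am"
    using order_trans[OF norm_ge_zero Ap[of 0]] order_trans[OF norm_ge_zero Am[of 0]] by auto
  have Vp: "Vp = integral {0..real N} (\<lambda>p. norm (w' p))" and Vm: "Vm = integral {- real N..0} (\<lambda>p. norm (w' p))"
    unfolding Vp_def Vm_def by (rule L1_norm_eq_integral[OF w'])+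
  have Vp0: "0 \<le> Vp" and Vm0: "0 \<le> Vm"
    using w' unfolding Vp Vm
    by (auto intro!: Henstock_Kurzweil_Integration.integral_nonneg simp: absolutely_integrable_on_def)
  \<comment> \<open>Being values of the second derivative, the minima inherit its strict positivity,
    which a mere infimum need not.\<close>
  have "ap \<in> deriv (deriv f) ` {0..real N}" "am \<in> deriv (deriv f) ` {- real N..0}"
    unfolding ap_def am_def by (intro Least_image_Icc(1) f_der(3); simp)+
  then have ap0: "0 < ap" and am0: "0 < am"
    using f_convex by force+
  have ap: "ap \<le> deriv (deriv f) p" if "p \<in> {0..real N}" for p
    unfolding ap_def using that by (intro Least_image_Icc(2) f_der(3)) simp_all
  have am: "am \<le> deriv (deriv f) p" if "p \<in> {- real N..0}" for p
    unfolding am_def using that by (intro Least_image_Icc(2) f_der(3)) simp_all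

  have const1_ge: "1 / (2 * pi) * (Bp + Bm) \<le> const1 f w \<mu> R"
  proof -
    have *: "1 / (2 * pi) * (4 / \<mu> * A + 2 / a * (3 * A + V))
        \<le> 1 / (2 * pi) * (5 / \<mu>) * A + 1 / (2 * pi) * (4 * A + V) * m"
      if "0 \<le> A" "0 \<le> V" "0 < a" "2 / a \<le> m" for A V a m :: real
    proof -
      have "0 \<le> 2 / a" using that by simp
      then have "2 / a * (3 * A + V) \<le> m * (4 * A + V)"
        using that by (intro mult_mono) linarith+
      moreover have "4 / \<mu> * A \<le> 5 / \<mu> * A"
        using that \<mu> by (intro mult_right_mono divide_right_mono) auto
      ultimately have "1 / (2 * pi) * (4 / \<mu> * A + 2 / a * (3 * A + V)) \<le> 1 / (2 * pi) * (5 / \<mu> * A + m * (4 * A + V))"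
        by (intro mult_left_mono add_mono) auto
      then show ?thesis by (simp add: algebra_simps)
    qed
    have "1 / (2 * pi) * Bp \<le> c_plus f w \<mu> (\<lceil>R\<rceil> + 1)"
      unfolding c_plus_def Let_def N_real w'_def[symmetric] Ap_def[symmetric] Vp_def[symmetric] Bp_def
      using m_plus_minus_ge(1)[OF f_smooth f_convex, of "\<lceil>R\<rceil> + 1", unfolded N_real]
      by (intro * Ap0 Vp0 ap0) (simp add: ap_def)
    moreover have "1 / (2 * pi) * Bm \<le> c_minus f w \<mu> (\<lceil>R\<rceil> + 1)"
      unfolding c_minus_def Let_def N_real w'_def[symmetric] Am_def[symmetric] Vm_def[symmetric] Bm_def
      using m_plus_minus_ge(2)[OF f_smooth f_convex, of "\<lceil>R\<rceil> + 1", unfolded N_real]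
      by (intro * Am0 Vm0 am0) (simp add: am_def)
    ultimately show ?thesis
      unfolding const1_def Let_def by (simp add: distrib_left)
  qed
  have const2: "1 / pi * C2 \<le> const2 \<alpha> \<mu> \<beta> c M M'"
    unfolding C2_def using \<mu> \<beta> \<alpha> c M M' by (intro const2_ge) auto
  \<comment> \<open>For the case where \<open>H\<close> is not integrable: the integral is then 0
    and the bound only has to be nonnegative.\<close>
  have B0: "0 \<le> Bp" "0 \<le> Bm" "0 \<le> C2"
    using Ap0 Am0 Vp0 Vm0 ap0 am0 \<mu> \<alpha> \<beta> c M M' by (simp_all add: Bp_def Bm_def C2_def)

  \<comment> \<open>\<open>H\<close> collects all that is independent of \<open>x\<close>, so that
    \<open>u t\<close> is a Fourier integral.\<close>
  define H where "H p = Fu0 p * cis (- (t * f p))" for p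
  have u_eq: "u t x = of_real (1 / (2 * pi)) * (LINT p|lebesgue. H p * cis (x * p))" for x
  proof -
    have "Fu0 p * exp (- \<i> * of_real t * of_real (f p) + \<i> * of_real x * of_real p) = H p * cis (x * p)" for p
      by (simp add: H_def cis_conv_exp mult.assoc algebra_simps flip: exp_add)
    then show ?thesis using u[of t x] t by simp
  qed

  \<comment> \<open>Integrability of \<open>H\<close> does follow from the hypotheses, but the case distinction is cheaper: if it
    failed, the Bochner integral would take the junk value \<open>0\<close>.\<close>
  have integral_0: "(LINT p|lebesgue. H p * cis (x * p)) = 0" if "\<not> integrable lebesgue H" for x
    using that by (intro not_integrable_integral_eq) (simp add: integrable_cis_mult_iff)

  have integral_le: "norm (LINT p|lebesgue. H p * cis (x * p))
      \<le> (Bp + Bm) * t powr (- \<mu> / 2) + 2 * C2 * t powr (- 1 / 2)"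
    if H: "integrable lebesgue H" for x
  proof (rule norm_lebesgue_integral_le_truncations)
    show Hx: "integrable lebesgue (\<lambda>p. H p * cis (x * p))"
      using H by (simp add: integrable_cis_mult_iff)
    fix K :: nat assume K: "N \<le> K"
    \<comment> \<open>The part linear in \<open>p\<close> disappears from \<open>\<theta>2\<close>,
      so its lower bounds, and with them the estimate, are uniform in \<open>x\<close>.\<close>
    define \<theta> where "\<theta> p = t * f p - x * p" for p
    define \<theta>1 where "\<theta>1 p = t * deriv f p - x" for p
    define \<theta>2 where "\<theta>2 p = t * deriv (deriv f) p" for p
    \<comment> \<open>\<open>P\<close> can differ from the integrand only at 0, a null set: there
      \<open>Fu0\<close> is unconstrained, while \<open>P 0 = 0\<close> even for
      \<open>\<mu> = 1\<close>, since \<open>0 powr 0 = 0\<close>.\<close>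
    define P where "P p = of_real (\<bar>p\<bar> powr (\<mu> - 1)) * w p * cis (- \<theta> p)" for p
    have P: "H p * cis (x * p) = P p" if "p \<noteq> 0" for p
      using that by (simp add: H_def P_def \<theta>_def Fu0_eq mult.assoc cis_mult)
    have "(\<lambda>p. H p * cis (x * p)) absolutely_integrable_on {- real K..real K}"
      using Hx by (auto simp: set_integrable_def intro: integrable_mult_indicator)
    then have "(\<lambda>p. H p * cis (x * p)) integrable_on {- real K..real K}"
      by (rule set_lebesgue_integral_eq_integral(1))
    then have P_int: "P integrable_on {- real K..real K}"
      by (rule integrable_spike[where S = "{0}"]) (auto simp: P)
    have \<theta>_der: "(\<theta> has_real_derivative \<theta>1 p) (at p)" "(\<theta>1 has_real_derivative \<theta>2 p) (at p)" for p
      unfolding \<theta>_def \<theta>1_def \<theta>2_def by (auto intro!: derivative_eq_intros f_der(1,2))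
    have \<theta>2_cont: "continuous_on UNIV \<theta>2"
      unfolding \<theta>2_def by (intro continuous_intros f_der(3))
    have f_far: "t * (c * \<bar>p\<bar> powr (- \<beta>)) \<le> \<theta>2 p" if "real N \<le> \<bar>p\<bar>" for p
      unfolding \<theta>2_def using t that N by (intro mult_left_mono f_lower) auto

    have P_eq: "integral {0..real K} P = integral {0..real K} (\<lambda>p. of_real (p powr (\<mu> - 1)) * w p * cis (- \<theta> p))"
      by (rule integral_cong) (auto simp: P_def)
    have right: "norm (integral {0..real K} P) \<le> Bp * t powr (- \<mu> / 2) + C2 * t powr (- 1 / 2)"
      unfolding Bp_def C2_def P_eq
    proof (rule dispersive_half_line[OF t N(1) K \<mu> \<beta> \<alpha> ap0 c \<theta>_der \<theta>2_cont _ _ w w'])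
      show "t * ap \<le> \<theta>2 p" if "0 \<le> p" "p \<le> real N" for p
        unfolding \<theta>2_def using that t by (intro mult_left_mono ap) auto
      show "t * (c * p powr (- \<beta>)) \<le> \<theta>2 p" if "real N \<le> p" for p
        using f_far[of p] that N by simp
      show "norm (w p) \<le> M * p powr (- \<alpha>)" if "real N \<le> p" for p
        using w_le[of p] that N by simp
      show "integral {real n..real n + 1} (\<lambda>p. norm (w' p)) \<le> M' * real n powr (- \<alpha>)" if "N \<le> n" for n
        using w'_decay[of "int n"] that N r L1_norm_eq_integral[OF w', of "real n" "real n + 1"]
        by (simp add: w'_def[abs_def])
      have "P integrable_on {0..real K}"
        by (rule integrable_on_subinterval[OF P_int]) auto
      then show "(\<lambda>p. of_real (p powr (\<mu> - 1)) * w p * cis (- \<theta> p)) integrable_on {0..real K}"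
        by (rule integrable_eq) (auto simp: P_def)
    qed (use Ap Vp M M' in auto)

    have P_refl: "integral {- real K..0} P
        = integral {0..real K} (\<lambda>p. of_real (p powr (\<mu> - 1)) * w (- p) * cis (- \<theta> (- p)))"
    proof -
      have "integral {- real K..0} P = integral {0..real K} (\<lambda>p. P (- p))"
        using Henstock_Kurzweil_Integration.integral_reflect_real[of "real K" 0 "\<lambda>p. P (- p)"] by simp
      also have "\<dots> = integral {0..real K} (\<lambda>p. of_real (p powr (\<mu> - 1)) * w (- p) * cis (- \<theta> (- p)))"
        by (rule integral_cong) (auto simp: P_def)
      finally show ?thesis .
    qed
    have norm_w'_refl: "integral {a..b} (\<lambda>p. norm (- w' (- p))) = integral {- b..- a} (\<lambda>p. norm (w' p))" for a b
      using Henstock_Kurzweil_Integration.integral_reflect_real[of b a "\<lambda>p. norm (w' (- p))"] by simp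
    \<comment> \<open>Reflection flips the sign of the first derivative of the phase but not of the
      second, so convexity and its lower bounds survive.\<close>
    have left: "norm (integral {- real K..0} P) \<le> Bm * t powr (- \<mu> / 2) + C2 * t powr (- 1 / 2)"
      unfolding Bm_def C2_def P_refl
    proof (rule dispersive_half_line[OF t N(1) K \<mu> \<beta> \<alpha> am0 c,
          where w' = "\<lambda>p. - w' (- p)" and ?\<theta>1.0 = "\<lambda>p. - \<theta>1 (- p)" and ?\<theta>2.0 = "\<lambda>p. \<theta>2 (- p)"])
      show "((\<lambda>p. \<theta> (- p)) has_real_derivative - \<theta>1 (- p)) (at p)" for p
        by (rule DERIV_mirror[THEN iffD1]) (simp add: \<theta>_der)
      show "((\<lambda>p. - \<theta>1 (- p)) has_real_derivative \<theta>2 (- p)) (at p)" for p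
        using DERIV_minus[OF DERIV_mirror[THEN iffD1, OF \<theta>_der(2)]] by simp
      show "continuous_on UNIV (\<lambda>p. \<theta>2 (- p))"
        by (intro continuous_on_compose2[OF \<theta>2_cont] continuous_intros) auto
      show "((\<lambda>p. w (- p)) has_vector_derivative - w' (- p)) (at p)" for p
        using vector_diff_chain_at[of uminus "- 1" p w "w' (- p)"] w[of "- p"]
        by (simp add: comp_def has_vector_derivative_minus has_vector_derivative_id)
      show "(\<lambda>p. - w' (- p)) absolutely_integrable_on {a..b}" for a b
      proof -
        have "(\<lambda>p. w' (- p)) absolutely_integrable_on {a..b}"
          using absolutely_integrable_reflect_real[of "- a" "- b" w'] w'[of "- b" "- a"] by simp
        then show ?thesis by (simp add: absolutely_integrable_on_def integrable_neg)
      qed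
      show "t * am \<le> \<theta>2 (- p)" if "0 \<le> p" "p \<le> real N" for p
        unfolding \<theta>2_def using that t by (intro mult_left_mono am) auto
      show "t * (c * p powr (- \<beta>)) \<le> \<theta>2 (- p)" if "real N \<le> p" for p
        using f_far[of "- p"] that N by simp
      show "norm (w (- p)) \<le> M * p powr (- \<alpha>)" if "real N \<le> p" for p
        using w_le[of "- p"] that N by simp
      show "integral {0..real N} (\<lambda>p. norm (- w' (- p))) \<le> Vm"
        unfolding norm_w'_refl Vm by simp
      \<comment> \<open>The mirror image of \<open>{n..n + 1}\<close> has left end
        \<open>- n - 1\<close>. The decay hypothesis at that index yields \<open>n + 1\<close> in
        place of \<open>n\<close>, which is enough because the power decreases.\<close>
      show "integral {real n..real n + 1} (\<lambda>p. norm (- w' (- p))) \<le> M' * real n powr (- \<alpha>)" if n: "N \<le> n" for n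
      proof -
        have "integral {real n..real n + 1} (\<lambda>p. norm (- w' (- p))) = L1_norm {- real n - 1<..<- real n} w'"
          unfolding norm_w'_refl L1_norm_eq_integral[OF w']
          by (simp only: minus_add_distrib diff_conv_add_uminus)
        also have "\<dots> \<le> M' * (real n + 1) powr (- \<alpha>)"
          using w'_decay[of "- int n - 1"] n N r by (simp add: w'_def[abs_def] add.commute)
        also have "\<dots> \<le> M' * real n powr (- \<alpha>)"
          using M' n N \<alpha> \<mu> \<beta> by (intro mult_left_mono powr_mono2') auto
        finally show ?thesis .
      qed
      have "(\<lambda>p. P (- p)) integrable_on {- real K..real K}"
        using Henstock_Kurzweil_Integration.integrable_reflect_real[of P "real K" "- real K"] P_int by simp
      then have "(\<lambda>p. P (- p)) integrable_on {0..real K}"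
        by (rule integrable_on_subinterval) auto
      then show "(\<lambda>p. of_real (p powr (\<mu> - 1)) * w (- p) * cis (- \<theta> (- p))) integrable_on {0..real K}"
        by (rule integrable_eq) (auto simp: P_def)
    qed (use Am M M' in auto)

    have "integral {- real K..real K} (\<lambda>p. H p * cis (x * p)) = integral {- real K..real K} P"
      by (rule integral_spike[where S = "{0}"]) (auto simp: P)
    also have "\<dots> = integral {- real K..0} P + integral {0..real K} P"
      using Henstock_Kurzweil_Integration.integral_combine[OF _ _ P_int, of 0] by simp
    also have "norm \<dots> \<le> norm (integral {- real K..0} P) + norm (integral {0..real K} P)"
      by (rule norm_triangle_ineq)
    also have "\<dots> \<le> (Bp + Bm) * t powr (- \<mu> / 2) + 2 * C2 * t powr (- 1 / 2)"
      using left right by (simp add: algebra_simps)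
    finally show "norm (integral {- real K..real K} (\<lambda>p. H p * cis (x * p)))
      \<le> (Bp + Bm) * t powr (- \<mu> / 2) + 2 * C2 * t powr (- 1 / 2)" .
  qed

  have u_le: "norm (u t x) \<le> const1 f w \<mu> R * t powr (- \<mu> / 2) + const2 \<alpha> \<mu> \<beta> c M M' * t powr (- 1 / 2)" for x
  proof -
    have "norm (LINT p|lebesgue. H p * cis (x * p))
        \<le> (Bp + Bm) * t powr (- \<mu> / 2) + 2 * C2 * t powr (- 1 / 2)"
    proof (cases "integrable lebesgue H")
      case False
      then show ?thesis using B0 by (simp add: integral_0)
    qed (rule integral_le)
    then have "norm (u t x) \<le> 1 / (2 * pi) * ((Bp + Bm) * t powr (- \<mu> / 2) + 2 * C2 * t powr (- 1 / 2))"
      unfolding u_eq norm_mult norm_of_real by (intro mult_mono) auto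
    \<comment> \<open>Both half-lines contribute the same \<open>C2\<close>, which turns
      \<open>1 / (2 * pi)\<close> into \<open>1 / pi\<close>.\<close>
    also have "\<dots> = (1 / (2 * pi) * (Bp + Bm)) * t powr (- \<mu> / 2) + (1 / pi * C2) * t powr (- 1 / 2)"
      by (simp add: field_simps)
    also have "\<dots> \<le> const1 f w \<mu> R * t powr (- \<mu> / 2) + const2 \<alpha> \<mu> \<beta> c M M' * t powr (- 1 / 2)"
      by (intro add_mono mult_right_mono const1_ge const2) auto
    finally show ?thesis .
  qed
  have "u t \<in> borel_measurable lebesgue"
  proof (cases "integrable lebesgue H")
    case True
    have "continuous_on UNIV (u t)"
      unfolding u_eq[abs_def] by (intro continuous_intros continuous_on_fourier_integral True)
    from continuous_imp_measurable_on_sets_lebesgue[OF this] show ?thesis by simp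
  next
    case False
    then have "u t = (\<lambda>x. 0)" by (simp add: u_eq integral_0 fun_eq_iff)
    then show ?thesis by simp
  qed
  then show "Linf_norm UNIV (u t)
      \<le> ereal (const1 f w \<mu> R * t powr (- \<mu> / 2) + const2 \<alpha> \<mu> \<beta> c M M' * t powr (- 1 / 2))"
    unfolding Linf_norm_def using u_le by (intro esssup_I) auto
qed

end
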